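(* Let $q$ be a fixed power of an odd prime and $\gamma$ a fixed generator of $\mathbb{F}_q^\times$. For every $\varepsilon>0$, as $g\to\infty$: (1) $\sum_{P\in\mathcal{P}_{2g+1}}L(1,\chi_P)=\zeta_A(2)\frac{|P|}{\log_q|P|}+O(|P|^{\frac12+\varepsilon})$ with $|P|=q^{2g+1}$; (2) $\sum_{P\in\mathcal{P}_{2g+2}}L(1,\chi_P)=\zeta_A(2)\frac{|P|}{\log_q|P|}+O(|P|^{\frac12+\varepsilon})$ with $|P|=q^{2g+2}$; (3) $\sum_{P\in\mathcal{P}_{2g+2}}L(1,\chi_{\gamma P})=\zeta_A(2)\frac{|P|}{\log_q|P|}+O(|P|^{\frac12+\varepsilon})$ with $|P|=q^{2g+2}$.
   Context: $A=\mathbb{F}_q[T]$ with $q$ odd. For nonzero $f\in A$, $|f|=q^{\deg f}$. $\mathcal{P}_n$ is the set of monic irreducible polynomials of degree $n$. For nonzero square-free $D\in A$, $\chi_D(f)=\left(\frac{D}{f}\right)$ is the Kronecker (Jacobi) symbol for monic $f$, and $L(s,\chi_D)=\sum_{f\text{ monic}}\chi_D(f)|f|^{-s}$ (a polynomial in $q^{-s}$). $\zeta_A(s)=\frac{1}{1-q^{1-s}}$. Implied constants may depend on $q$ and $\varepsilon$. *)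

theory Defs
  imports
    "HOL-Analysis.Analysis"
    "HOL-Computational_Algebra.Computational_Algebra"
    "HOL-Number_Theory.Cong"
    "HOL-Library.Landau_Symbols"
begin

text \<open>
  The field with \<open>q\<close> elements is a type \<open>'a\<close> of classes \<open>finite\<close> and \<open>field\<close>, so that
  \<open>q = CARD('a)\<close>, and the ring of polynomials in one variable over it is \<open>'a poly\<close>.
\<close>

definition pnorm :: "'a::{finite,field} poly \<Rightarrow> real" where
  "pnorm f = (if f = 0 then 0 else real CARD('a) ^ degree f)"

definition monics :: "nat \<Rightarrow> 'a::{finite,field} poly set" where
  "monics n = {f. lead_coeff f = 1 \<and> degree f = n}"

definition monic_primes :: "nat \<Rightarrow> 'a::{finite,field} poly set" where
  "monic_primes n = {P. lead_coeff P = 1 \<and> irreducible P \<and> degree P = n}"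

definition field_generator :: "'a::{finite,field} \<Rightarrow> bool" where
  "field_generator \<gamma> \<longleftrightarrow> \<gamma> \<noteq> 0 \<and> (\<forall>x. x \<noteq> 0 \<longrightarrow> (\<exists>k::nat. x = \<gamma> ^ k))"

text \<open>The Legendre symbol modulo an irreducible \<open>P\<close>.\<close>

definition poly_legendre :: "'a::{finite,field} poly \<Rightarrow> 'a poly \<Rightarrow> int" where
  "poly_legendre D P =
     (if P dvd D then 0 else if \<exists>X. [X ^ 2 = D] (mod P) then 1 else -1)"

text \<open>
  The Jacobi symbol: the multiplicative extension of the Legendre symbol along the
  factorization of a nonzero \<open>f\<close> into monic irreducibles.  The exponent of \<open>P\<close> in \<open>f\<close> is
  written out because \<open>multiplicity\<close> and \<open>prime_factorization\<close> require \<open>factorial_semiring\<close>,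
  of which \<open>'a poly\<close> is not an instance for \<open>'a\<close> merely in class \<open>field\<close>.
\<close>

definition poly_jacobi :: "'a::{finite,field} poly \<Rightarrow> 'a poly \<Rightarrow> int" where
  "poly_jacobi D f =
     (\<Prod>P | lead_coeff P = 1 \<and> irreducible P \<and> P dvd f.
        poly_legendre D P ^ Max {k. P ^ k dvd f})"

text \<open>
  The series over all monic \<open>f\<close> of \<open>\<chi>\<^sub>D(f) |f|\<^sup>-\<^sup>s\<close>, with the terms grouped by degree.  For
  \<open>Re s > 1\<close> the ungrouped series converges absolutely and the grouping is immaterial.  For
  a nonconstant square-free \<open>D\<close> and \<open>n \<ge> degree D\<close> the \<open>n\<close>-th group vanishes for every
  \<open>s\<close>, so this is the polynomial in \<open>q\<^sup>-\<^sup>s\<close> that continues the series to the whole plane.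
  The point \<open>s = 1\<close> lies outside the region of absolute convergence.
\<close>

definition L_poly :: "complex \<Rightarrow> 'a::{finite,field} poly \<Rightarrow> complex" where
  "L_poly s D =
     (\<Sum>n. \<Sum>f\<in>monics n. of_int (poly_jacobi D f) * of_real (pnorm f) powr (-s))"

definition zeta_A :: "'a::{finite,field} itself \<Rightarrow> complex \<Rightarrow> complex" where
  "zeta_A _ s = 1 / (1 - of_nat CARD('a) powr (1 - s))"

end

theory Submission
  imports "HOL-Algebra.Algebraic_Closure_Type" Defs
begin

text \<open>
  Summing over the primes first, the perfect squares \<open>f = l\<^sup>2\<close> of degree less than \<open>n = deg P\<close>
  contribute \<open>|\<P>\<^sub>n| \<Sum> |l|\<^sup>-\<^sup>1\<close>, which is the main term.  For any other \<open>f\<close>, reciprocity turns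
  \<open>\<chi>\<^sub>P(f)\<close> into \<open>\<plusminus>\<chi>(f(\<alpha>))\<close>, where \<open>\<alpha>\<close> is a root of \<open>P\<close> and \<open>\<chi>\<close> the quadratic character of the
  field with \<open>Q = q\<^sup>n\<close> elements, and the sign depends only on the degrees.  Up to the
  \<open>O(Q\<^sup>1\<^sup>/\<^sup>2)\<close> elements of proper subfields, the sum over \<open>P\<close> is thus \<open>1/n\<close> times the complete sum
  \<open>\<Sum> \<chi>(f(x))\<close> over that field, and \<open>deg f < n\<close> is tiny compared with \<open>Q\<close>, so that Stepanov's
  method gives \<open>O(n Q\<^sup>1\<^sup>/\<^sup>2)\<close>, even without passing to an \<open>L\<close>-function.

  The auxiliary polynomial is \<open>G = \<Sum> (a\<^sub>j + b\<^sub>j f\<^bsup>(E+1)/2\<^esup>) X\<^bsup>jE\<^esup>\<close> with \<open>Q = M E\<close>, where \<open>M\<close> and \<open>E\<close> are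
  powers of \<open>q\<close> near \<open>Q\<^sup>1\<^sup>/\<^sup>2\<close>.  On the points where \<open>\<chi>(f(x))\<close> is \<open>0\<close> or a given sign, \<open>G\<^sup>M\<close>
  agrees with a polynomial of low degree, which the pigeonhole principle makes zero for some choice
  of \<open>a\<^sub>j\<close> and \<open>b\<^sub>j\<close>.
\<close>

section \<open>Finite fields inside the algebraic closure\<close>

lemma card_field_gt_1: "CARD('a::{finite,field}) > 1"
proof -
  have "card {0, 1 :: 'a} \<le> CARD('a)"
    by (rule card_mono) auto
  thus ?thesis by simp
qed

text \<open>Multiplication by a nonzero \<open>x\<close> permutes the nonzero elements, so their
  product absorbs the factor \<open>x ^ (q - 1)\<close>, which must be 1.\<close>

lemma finite_field_power_card:
  fixes x :: "'a::{finite,field}"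
  shows "x ^ CARD('a) = x"
proof (cases "x = 0")
  case True
  thus ?thesis using card_field_gt_1[where 'a='a] by (simp add: power_0_left)
next
  case False
  let ?U = "UNIV - {0 :: 'a}"
  have "bij_betw (\<lambda>y. x * y) ?U ?U"
    by (rule bij_betwI[where g = "\<lambda>y. y / x"]) (use False in auto)
  hence "(\<Prod>y\<in>?U. x * y) = (\<Prod>y\<in>?U. y)"
    by (rule prod.reindex_bij_betw)
  hence "x ^ card ?U * (\<Prod>y\<in>?U. y) = (\<Prod>y\<in>?U. y)"
    by (simp add: prod.distrib)
  moreover have "(\<Prod>y\<in>?U. y) \<noteq> 0" by simp
  ultimately have "x ^ card ?U = 1" by simp
  hence "x * x ^ (CARD('a) - 1) = x" by (simp add: card_Diff_singleton)
  thus ?thesis using card_field_gt_1[where 'a='a] by (simp flip: power_Suc)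
qed

lemma to_ac_power_card: "to_ac x ^ CARD('a) = to_ac (x :: 'a::{finite,field})"
  by (metis finite_field_power_card to_ac_power)

lemma poly_eq_0_of_card_roots:
  fixes p :: "'b::idom poly"
  assumes "\<And>x. x \<in> A \<Longrightarrow> poly p x = 0" "degree p < card A"
  shows "p = 0"
proof (rule ccontr)
  assume "p \<noteq> 0"
  hence "card A \<le> card {x. poly p x = 0}"
    by (intro card_mono poly_roots_finite) (use assms in auto)
  also have "\<dots> \<le> degree p" using \<open>p \<noteq> 0\<close> by (rule card_poly_roots_bound)
  finally show False using assms(2) by simp
qed

lemma degree_power_add_const_diff:
  fixes c d :: "'b::idom"
  assumes "n > 0"
  shows "degree ([:c, 1:] ^ n - monom 1 n - [:d:]) < n"
proof (rule degree_lessI)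
  show "[:c, 1:] ^ n - monom 1 n - [:d:] \<noteq> 0 \<or> n > 0" using assms by simp
  have deg: "degree ([:c, 1:] ^ n) = n" by (simp add: degree_power_eq)
  have lead: "coeff ([:c, 1:] ^ n) n = 1"
    using lead_coeff_power[of "[:c,1:]" n] by (simp add: deg)
  show "\<forall>k\<ge>n. coeff ([:c, 1:] ^ n - monom 1 n - [:d:]) k = 0"
  proof (intro allI impI)
    fix k assume k: "k \<ge> n"
    have "coeff [:d:] k = 0" using assms k by (cases k) auto
    thus "coeff ([:c, 1:] ^ n - monom 1 n - [:d:]) k = 0"
      using k lead by (cases "k = n") (auto simp: deg coeff_eq_0)
  qed
qed

text \<open>
  The polynomial \<open>(X + Y)\<^sup>q - X\<^sup>q - Y\<^sup>q\<close> has degree less than \<open>q\<close> in each variable and vanishes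
  on \<open>\<F>\<^sub>q \<times> \<F>\<^sub>q\<close>; so it is zero, and \<open>q\<close> need not be recognised as a prime power.
\<close>
lemma frobenius_add:
  fixes x y :: "'a::{finite,field} alg_closure"
  shows "(x + y) ^ CARD('a) = x ^ CARD('a) + y ^ CARD('a)"
proof -
  let ?q = "CARD('a)"
  have q: "?q > 0" by simp
  have card: "card (range (to_ac :: 'a \<Rightarrow> _)) = ?q"
    by (simp add: card_image inj_to_ac)
  have 1: "[:to_ac c, 1:] ^ ?q - monom 1 ?q - [:to_ac c:] = 0" for c :: 'a
  proof (rule poly_eq_0_of_card_roots)
    show "degree ([:to_ac c, 1:] ^ ?q - monom 1 ?q - [:to_ac c:]) < card (range (to_ac :: 'a \<Rightarrow> _))"
      unfolding card by (rule degree_power_add_const_diff[OF q])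
    fix z :: "'a alg_closure" assume "z \<in> range to_ac"
    then obtain d :: 'a where "z = to_ac d" by blast
    moreover have "(to_ac c + to_ac d) ^ ?q = to_ac c + to_ac d"
      by (metis to_ac_add to_ac_power_card)
    ultimately show "poly ([:to_ac c, 1:] ^ ?q - monom 1 ?q - [:to_ac c:]) z = 0"
      by (simp add: poly_monom to_ac_power_card)
  qed
  \<comment> \<open>Now \<open>x\<close> is arbitrary, and the roots \<open>z = to_ac d\<close> come
    from fact \<open>1\<close>, read with the two variables exchanged.\<close>
  have "[:x, 1:] ^ ?q - monom 1 ?q - [:x ^ ?q:] = 0"
  proof (rule poly_eq_0_of_card_roots)
    show "degree ([:x, 1:] ^ ?q - monom 1 ?q - [:x ^ ?q:]) < card (range (to_ac :: 'a \<Rightarrow> _))"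
      unfolding card by (rule degree_power_add_const_diff[OF q])
    fix z :: "'a alg_closure" assume "z \<in> range to_ac"
    then obtain d :: 'a where z: "z = to_ac d" by blast
    have "poly ([:to_ac d, 1:] ^ ?q - monom 1 ?q - [:to_ac d:]) x = 0"
      using 1[of d] by (metis poly_0)
    thus "poly ([:x, 1:] ^ ?q - monom 1 ?q - [:x ^ ?q:]) z = 0"
      by (simp add: poly_monom z to_ac_power_card algebra_simps)
  qed
  hence "poly ([:x, 1:] ^ ?q - monom 1 ?q - [:x ^ ?q:]) y = 0"
    by (metis poly_0)
  thus ?thesis by (simp add: poly_monom algebra_simps)
qed

lemma frobenius_pow_add:
  fixes x y :: "'a::{finite,field} alg_closure"
  shows "(x + y) ^ (CARD('a) ^ k) = x ^ (CARD('a) ^ k) + y ^ (CARD('a) ^ k)"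
proof (induction k)
  case (Suc k)
  thus ?case by (simp add: power_mult mult.commute[of "CARD('a)"] frobenius_add)
qed simp

lemma frobenius_pow_sum:
  fixes h :: "'b \<Rightarrow> 'a::{finite,field} alg_closure"
  shows "(\<Sum>i\<in>I. h i) ^ (CARD('a) ^ k) = (\<Sum>i\<in>I. h i ^ (CARD('a) ^ k))"
  by (induction I rule: infinite_finite_induct) (auto simp: frobenius_pow_add power_0_left)

lemma frobenius_pow_inj:
  fixes x y :: "'a::{finite,field} alg_closure"
  assumes "x ^ (CARD('a) ^ k) = y ^ (CARD('a) ^ k)"
  shows "x = y"
proof -
  have "x ^ (CARD('a) ^ k) = (x - y) ^ (CARD('a) ^ k) + y ^ (CARD('a) ^ k)"
    by (metis diff_add_cancel frobenius_pow_add)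
  with assms show ?thesis by simp
qed

lemma to_ac_frobenius_pow: "to_ac (c :: 'a::{finite,field}) ^ (CARD('a) ^ k) = to_ac c"
  by (induction k) (auto simp: power_mult mult.commute[of "CARD('a)"] to_ac_power_card)

text \<open>Translation by 1 permutes the field, so adding 1 to each of the q summands leaves the
  total unchanged.\<close>

lemma of_nat_card_eq_0: "of_nat CARD('a) = (0 :: 'a::{finite,field} alg_closure)"
proof -
  have "(\<Sum>y\<in>(UNIV :: 'a set). y + 1) = (\<Sum>y\<in>UNIV. y)"
    by (rule sum.reindex_bij_betw[where h = "\<lambda>y. y + 1"], rule bij_betwI[where g = "\<lambda>y. y - 1"]) auto
  hence "of_nat CARD('a) = (0 :: 'a)"
    by (simp add: sum.distrib)
  thus ?thesis by (metis to_ac_0 to_ac_of_nat)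
qed

lemma one_neq_minus_one:
  assumes "odd CARD('a::{finite,field})"
  shows "(1 :: 'a alg_closure) \<noteq> -1"
proof
  assume "(1 :: 'a alg_closure) = -1"
  hence "1 + 1 = (0 :: 'a alg_closure)" by (metis add.right_inverse)
  hence "of_nat 2 = (0 :: 'a alg_closure)" by simp
  moreover from assms obtain k where "CARD('a) = 2 * k + 1" by (rule oddE)
  hence "of_nat (2 * k + 1) = (0 :: 'a alg_closure)" using of_nat_card_eq_0[where 'a='a] by simp
  ultimately have "(1 :: 'a alg_closure) = 0" by (simp only: of_nat_add of_nat_mult) simp
  thus False by simp
qed

section \<open>Evaluation of polynomials over F_q at points of the closure\<close>

definition eval_ac :: "'a::{finite,field} poly \<Rightarrow> 'a alg_closure \<Rightarrow> 'a alg_closure" where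
  "eval_ac f x = poly (map_poly to_ac f) x"

lemma eval_ac_0 [simp]: "eval_ac 0 x = 0"
  by (simp add: eval_ac_def)

lemma eval_ac_pCons [simp]: "eval_ac (pCons a p) x = to_ac a + x * eval_ac p x"
  by (simp add: eval_ac_def map_poly_pCons)

lemma eval_ac_1 [simp]: "eval_ac 1 x = 1"
  by (simp add: one_pCons)

lemma eval_ac_add [simp]: "eval_ac (p + r) x = eval_ac p x + eval_ac r x"
  by (induction p r rule: poly_induct2) (auto simp: algebra_simps)

lemma eval_ac_smult [simp]: "eval_ac (smult c p) x = to_ac c * eval_ac p x"
  by (induction p) (auto simp: algebra_simps)

lemma eval_ac_mult [simp]: "eval_ac (p * r) x = eval_ac p x * eval_ac r x"
  by (induction p) (auto simp: algebra_simps)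

lemma eval_ac_minus [simp]: "eval_ac (- p) x = - eval_ac p x"
  using eval_ac_smult[of "-1" p x] by simp

lemma eval_ac_diff [simp]: "eval_ac (p - r) x = eval_ac p x - eval_ac r x"
  using eval_ac_add[of p "-r" x] by simp

lemma eval_ac_power [simp]: "eval_ac (p ^ n) x = eval_ac p x ^ n"
  by (induction n) auto

lemma eval_ac_sum [simp]: "eval_ac (\<Sum>i\<in>I. p i) x = (\<Sum>i\<in>I. eval_ac (p i) x)"
  by (induction I rule: infinite_finite_induct) auto

lemma eval_ac_monom [simp]: "eval_ac (monom c n) x = to_ac c * x ^ n"
  by (simp add: eval_ac_def map_poly_monom poly_monom)

lemma eval_ac_pcompose [simp]: "eval_ac (pcompose p r) x = eval_ac p (eval_ac r x)"
  by (induction p) (auto simp: pcompose_pCons algebra_simps)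

lemma degree_map_poly_to_ac [simp]: "degree (map_poly to_ac p) = degree p"
  by (rule degree_map_poly) auto

lemma map_poly_to_ac_eq_0_iff [simp]: "map_poly to_ac p = 0 \<longleftrightarrow> p = 0"
  by (rule map_poly_eq_0_iff) auto

lemma finite_eval_ac_roots: "p \<noteq> 0 \<Longrightarrow> finite {x. eval_ac p x = 0}"
  unfolding eval_ac_def by (rule poly_roots_finite) simp

lemma card_eval_ac_roots_le: "p \<noteq> 0 \<Longrightarrow> card {x. eval_ac p x = 0} \<le> degree p"
  unfolding eval_ac_def using card_poly_roots_bound[of "map_poly to_ac p"] by simp

text \<open>The Frobenius fixes the coefficients, which lie in F_q, so only the argument is raised
  to the power.\<close>

lemma eval_ac_frobenius_pow:
  fixes p :: "'a::{finite,field} poly"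
  shows "eval_ac p x ^ (CARD('a) ^ k) = eval_ac p (x ^ (CARD('a) ^ k))"
  by (induction p)
     (auto simp: frobenius_pow_add to_ac_frobenius_pow power_mult_distrib power_0_left)

text \<open>For \<open>k > 0\<close> this is the subfield with \<open>q ^ k\<close> elements. For
  \<open>k = 0\<close> the condition is void and the set is the whole closure.\<close>

definition fixed_field :: "nat \<Rightarrow> 'a::{finite,field} alg_closure set" where
  "fixed_field k = {x. x ^ (CARD('a) ^ k) = x}"

lemma card_power_gt_1: "k > 0 \<Longrightarrow> CARD('a::{finite,field}) ^ k > 1"
  using one_less_power[OF card_field_gt_1[where 'a='a]] by blast

text \<open>\<open>X ^ Q - X\<close> splits in the closure, and its derivative is the constant -1
  because \<open>Q\<close> is 0 there, so its \<open>Q\<close> roots are distinct.\<close>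

lemma
  assumes "k > 0"
  shows finite_fixed_field: "finite (fixed_field k :: 'a::{finite,field} alg_closure set)"
    and card_fixed_field: "card (fixed_field k :: 'a alg_closure set) = CARD('a) ^ k"
proof -
  define Q where "Q = CARD('a) ^ k"
  have Q: "Q > 1" unfolding Q_def by (rule card_power_gt_1[OF assms])
  define p where "p = monom 1 Q - [:0, 1 :: 'a alg_closure:]"
  have degp: "degree p = Q"
  proof -
    have "degree p = degree (monom (1 :: 'a alg_closure) Q)"
      unfolding p_def diff_conv_add_uminus
      by (rule degree_add_eq_left) (use Q in \<open>simp add: degree_monom_eq\<close>)
    thus ?thesis by (simp add: degree_monom_eq)
  qed
  have p0: "p \<noteq> 0" using degp Q by auto
  have roots: "fixed_field k = {x. poly p x = 0}"
    by (auto simp: fixed_field_def p_def poly_monom Q_def)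
  show "finite (fixed_field k :: 'a alg_closure set)"
    unfolding roots by (rule poly_roots_finite[OF p0])
  obtain A where A: "size A = degree p" "p = smult (lead_coeff p) (\<Prod>x\<in>#A. [:-x, 1:])"
    using alg_closed_imp_factorization[OF p0] by blast
  have lc: "lead_coeff p \<noteq> 0" using p0 by simp
  have "poly p x = lead_coeff p * (\<Prod>y\<in>#A. x - y)" for x
    by (subst A(2)) (simp add: poly_prod_mset image_mset.compositionality o_def)
  hence setA: "set_mset A = {x. poly p x = 0}"
    using lc by (auto simp: prod_mset_zero_iff)
  have pder: "poly (pderiv p) x = -1" for x
  proof -
    have "of_nat Q = (0 :: 'a alg_closure)"
      using assms by (simp add: Q_def of_nat_card_eq_0)
    thus ?thesis by (simp add: p_def pderiv_diff pderiv_monom pderiv_pCons)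
  qed
  have "count A x \<le> 1" for x
  proof (rule ccontr)
    assume "\<not> count A x \<le> 1"
    then obtain B where "A = add_mset x (add_mset x B)"
      by (metis One_nat_def add_mset_remove_trivial_eq count_add_mset count_greater_zero_iff
          diff_add_zero insert_DiffM linorder_not_le less_Suc_eq_le not_gr_zero plus_1_eq_Suc zero_less_Suc
          add_diff_cancel_left' count_diff)
    hence "p = [:-x, 1:] * ([:-x, 1:] * smult (lead_coeff p) (\<Prod>y\<in>#B. [:-y, 1:]))"
      using A(2) by (simp add: ac_simps)
    then obtain r where "p = [:-x, 1:] * ([:-x, 1:] * r)" by blast
    then obtain h where h: "p = [:-x, 1:] * h" "poly h x = 0" by simp
    have "poly (pderiv p) x = 0" unfolding h(1) pderiv_mult using h(2) by simp
    thus False using pder by simp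
  qed
  hence "A = mset_set (set_mset A)"
    by (intro multiset_eqI)
       (metis count_mset_set(1,3) finite_set_mset le_antisym not_in_iff  count_greater_eq_one_iff)
  hence "card (set_mset A) = size A" by (metis size_mset_set)
  thus "card (fixed_field k :: 'a alg_closure set) = CARD('a) ^ k"
    unfolding roots using setA A(1) degp by (simp add: Q_def)
qed

section \<open>Polynomials over a finite field\<close>

text \<open>A condition on coefficients instead of the degree makes \<open>polys_lt 0\<close> equal
  to \<open>{0}\<close>, so that the count \<open>q ^ n\<close> holds for \<open>n = 0\<close> as
  well.\<close>

definition polys_lt :: "nat \<Rightarrow> 'b::zero poly set" where
  "polys_lt n = {p. \<forall>k\<ge>n. coeff p k = 0}"

lemma polys_lt_iff_degree: "n > 0 \<Longrightarrow> p \<in> polys_lt n \<longleftrightarrow> degree p < n"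
  unfolding polys_lt_def
  by (auto simp: coeff_eq_0 intro: degree_lessI)

lemma polys_lt_0: "polys_lt 0 = {0}"
  by (auto simp: polys_lt_def poly_eq_iff)

lemma polys_lt_Suc: "polys_lt (Suc n) = (\<lambda>(a, p). pCons a p) ` (UNIV \<times> polys_lt n)"
proof (intro equalityI subsetI)
  fix p :: "'b::zero poly" assume p: "p \<in> polys_lt (Suc n)"
  obtain a r where [simp]: "p = pCons a r" by (cases p)
  have "r \<in> polys_lt n"
    using p by (auto simp: polys_lt_def)
  thus "p \<in> (\<lambda>(a, p). pCons a p) ` (UNIV \<times> polys_lt n)" by force
next
  fix p :: "'b::zero poly" assume "p \<in> (\<lambda>(a, p). pCons a p) ` (UNIV \<times> polys_lt n)"
  thus "p \<in> polys_lt (Suc n)"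
    by (auto simp: polys_lt_def coeff_pCons split: nat.splits)
qed

lemma finite_polys_lt [simp]: "finite (polys_lt n :: 'a::{finite,field} poly set)"
  by (induction n) (auto simp: polys_lt_0 polys_lt_Suc)

lemma card_polys_lt: "card (polys_lt n :: 'a::{finite,field} poly set) = CARD('a) ^ n"
proof (induction n)
  case (Suc n)
  have "card (polys_lt (Suc n) :: 'a poly set) = card (UNIV \<times> polys_lt n :: ('a \<times> 'a poly) set)"
    unfolding polys_lt_Suc by (rule card_image) (auto simp: inj_on_def)
  thus ?case using Suc by (simp add: card_cartesian_product)
qed (simp add: polys_lt_0)

lemma diff_in_polys_lt:
  "p \<in> polys_lt n \<Longrightarrow> r \<in> polys_lt n \<Longrightarrow> p - r \<in> polys_lt n" for p :: "'b::ab_group_add poly"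
  by (auto simp: polys_lt_def)

lemma exists_irreducible_dvd:
  fixes p :: "'b::field poly"
  assumes "degree p > 0"
  shows "\<exists>r. irreducible r \<and> r dvd p"
  using assms
proof (induction "degree p" arbitrary: p rule: less_induct)
  case less
  show ?case
  proof (cases "irreducible p")
    case False
    have "p \<noteq> 0" using less.prems by auto
    hence "\<not> is_unit p" using less.prems by (simp add: is_unit_iff_degree)
    with \<open>p \<noteq> 0\<close> False obtain a b where ab: "p = a * b" "\<not> is_unit a" "\<not> is_unit b"
      unfolding irreducible_def by blast
    with \<open>p \<noteq> 0\<close> have "a \<noteq> 0" "b \<noteq> 0" by auto
    with ab have "degree a > 0" "degree b > 0"
      by (auto simp: is_unit_iff_degree)
    with ab \<open>a \<noteq> 0\<close> \<open>b \<noteq> 0\<close> less.hyps[of a] show ?thesis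
      by (auto simp: degree_mult_eq intro: dvd_trans)
  qed auto
qed

text \<open>An irreducible factor of \<open>b\<close> divides \<open>a ^ 2\<close>, hence
  \<open>a\<close>, and can be cancelled from both sides. The descent ends at a constant
  \<open>b\<close>, where \<open>f\<close> is the square of \<open>a\<close> divided by that
  constant.\<close>

lemma square_of_mult_square_eq_square:
  fixes f :: "'b::field poly"
  assumes "f * b ^ 2 = a ^ 2" "b \<noteq> 0"
  shows "\<exists>l. f = l ^ 2"
  using assms
proof (induction "degree b" arbitrary: a b rule: less_induct)
  case less
  show ?case
  proof (cases "degree b = 0")
    case True
    then obtain c where c: "b = [:c:]" by (auto elim: degree_eq_zeroE)
    with less.prems have "c \<noteq> 0" by auto
    have "smult (c\<^sup>2) f = a ^ 2" using less.prems(1) by (simp add: c power2_eq_square)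
    hence "f = smult (1 / c\<^sup>2) (a ^ 2)" using \<open>c \<noteq> 0\<close> by (metis power_eq_0_iff smult_1_left smult_smult
        nonzero_eq_divide_eq)
    hence "f = (smult (1 / c) a) ^ 2" by (simp add: smult_power power_divide)
    thus ?thesis ..
  next
    case False
    then obtain r where r: "irreducible r" "r dvd b"
      using exists_irreducible_dvd by blast
    have "r \<noteq> 0" "\<not> is_unit r" using r by (auto simp: irreducible_def)
    have "r dvd a ^ 2" using less.prems(1) r(2)
      by (metis dvd_mult dvd_trans dvd_triv_left power2_eq_square)
    hence "r dvd a"
      using field_poly_irreducible_imp_prime[OF r(1)] prime_elem_dvd_power by blast
    then obtain a' where a': "a = r * a'" by (elim dvdE)
    from r(2) obtain b' where b': "b = r * b'" by (elim dvdE)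
    have "r ^ 2 * (f * b' ^ 2) = r ^ 2 * a' ^ 2"
      using less.prems(1) by (simp add: a' b' power_mult_distrib ac_simps)
    hence "f * b' ^ 2 = a' ^ 2" using \<open>r \<noteq> 0\<close> by simp
    moreover have "b' \<noteq> 0" using less.prems(2) b' by auto
    moreover have "degree b' < degree b"
      using \<open>r \<noteq> 0\<close> \<open>\<not> is_unit r\<close> \<open>b' \<noteq> 0\<close> by (simp add: b' degree_mult_eq is_unit_iff_degree)
    ultimately show ?thesis using less.hyps by blast
  qed
qed

lemma degree_coeff_mult_le:
  fixes p r :: "'b::comm_ring_1 poly poly"
  assumes "\<And>n. degree (coeff p n) \<le> d" "\<And>n. degree (coeff r n) \<le> e"
  shows "degree (coeff (p * r) n) \<le> d + e"
  unfolding coeff_mult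
  by (intro degree_sum_le) (auto intro: order.trans[OF degree_mult_le] add_mono assms)

text \<open>Coefficients of degree below \<open>E\<close> act like digits in base \<open>E\<close>:
  after substituting \<open>X ^ E\<close> the terms occupy disjoint ranges of exponents and cannot
  cancel.\<close>

lemma bivariate_eq_0:
  fixes C :: "'b::idom poly poly"
  assumes "\<And>n. degree (coeff C n) < E" "poly C (monom 1 E) = 0"
  shows "C = 0"
  using assms
proof (induction C)
  case (pCons c C)
  have c: "degree c < E" using pCons.prems(1)[of 0] by simp
  have C: "degree (coeff C n) < E" for n using pCons.prems(1)[of "Suc n"] by simp
  have *: "c + monom 1 E * poly C (monom 1 E) = 0" using pCons.prems(2) by simp
  have "poly C (monom 1 E) = 0"
  proof (rule ccontr)
    assume nz: "poly C (monom 1 E) \<noteq> 0"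
    have "degree (monom 1 E * poly C (monom 1 E)) = E + degree (poly C (monom 1 E))"
      by (subst degree_mult_eq) (use nz in \<open>auto simp: degree_monom_eq monom_eq_0_iff\<close>)
    moreover have "monom 1 E * poly C (monom 1 E) = - c" using * by (metis add_eq_0_iff)
    ultimately show False using c by simp
  qed
  with pCons.IH C * show ?case by simp
qed simp

section \<open>Counting points where the quadratic character is constant\<close>

text \<open>
  A nontrivial relation would make \<open>f(X) f(Z)\<close> a square in \<open>K(X, Z)\<close> after substituting \<open>Z\<close>
  for \<open>X\<^sup>E\<close>, which loses nothing as all degrees in \<open>X\<close> are below \<open>E\<close>.
\<close>
lemma auxiliary_polynomial_nonzero:
  fixes f :: "'b::field poly" and a b :: "nat \<Rightarrow> 'b poly"
  assumes f: "lead_coeff f = 1" "\<nexists>l. f = l ^ 2"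
    and frob: "f ^ E = pcompose f (monom 1 E)" and "odd E"
    and deg: "\<And>j. degree (a j) \<le> d" "\<And>j. degree (b j) \<le> d" "2 * d + degree f < E"
    and nz: "\<exists>j<J. a j \<noteq> 0 \<or> b j \<noteq> 0"
  shows "(\<Sum>j<J. (a j + b j * f ^ ((E + 1) div 2)) * monom 1 (j * E)) \<noteq> 0"
proof
  assume zero: "(\<Sum>j<J. (a j + b j * f ^ ((E + 1) div 2)) * monom 1 (j * E)) = 0"
  define Z :: "'b poly" where "Z = monom 1 E"
  define A where "A = (\<Sum>j<J. monom (a j) j)"
  define B where "B = (\<Sum>j<J. monom (b j) j)"
  define F where "F = map_poly (\<lambda>c. [:c:]) f"
  have coeffA: "coeff A n = (if n < J then a n else 0)" for n
    by (auto simp: A_def coeff_sum sum.delta)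
  have coeffB: "coeff B n = (if n < J then b n else 0)" for n
    by (auto simp: B_def coeff_sum sum.delta)
  have coeffF: "coeff F n = [:coeff f n:]" for n
    by (simp add: F_def coeff_map_poly)
  have Zpow: "monom 1 (j * E) = Z ^ j" for j
    by (simp add: Z_def monom_power mult.commute)
  have "poly A Z + poly B Z * f ^ ((E + 1) div 2) = 0"
    using zero by (simp add: A_def B_def poly_sum poly_monom Zpow sum.distrib sum_distrib_left
        algebra_simps)
  hence "poly A Z = - (poly B Z * f ^ ((E + 1) div 2))"
    by (simp add: eq_neg_iff_add_eq_0)
  \<comment> \<open>Squaring turns the exponent \<open>(E + 1) div 2\<close> into
    \<open>E + 1\<close>, and \<open>f ^ E\<close> is \<open>f\<close> evaluated at
    \<open>Z\<close>. Both sides then become polynomials in \<open>Z\<close> whose coefficients have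
    degree below \<open>E\<close>.\<close>
  hence "(poly A Z)\<^sup>2 = (poly B Z)\<^sup>2 * (f ^ ((E + 1) div 2))\<^sup>2"
    by (simp add: power_mult_distrib)
  also have "(f ^ ((E + 1) div 2))\<^sup>2 = f * f ^ E"
    using \<open>odd E\<close> by (auto elim!: oddE simp: power2_eq_square mult_2 simp flip: power_add)
  also have "f ^ E = poly F Z" unfolding frob F_def Z_def by (simp add: pcompose_altdef)
  finally have "poly (A\<^sup>2 - [:f:] * (B\<^sup>2 * F)) Z = 0"
    by (simp add: algebra_simps)
  moreover have "degree (coeff (A\<^sup>2 - [:f:] * (B\<^sup>2 * F)) n) < E" for n
  proof -
    have A2: "degree (coeff (A\<^sup>2) n) \<le> d + d"
      unfolding power2_eq_square by (rule degree_coeff_mult_le) (auto simp: coeffA deg)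
    have 1: "degree (coeff (A\<^sup>2) n) < E" using A2 deg(3) by linarith
    have B2: "degree (coeff (B\<^sup>2) n) \<le> d + d" for n
      unfolding power2_eq_square by (rule degree_coeff_mult_le) (auto simp: coeffB deg)
    have "degree (coeff (B\<^sup>2 * F) n) \<le> (d + d) + 0"
      by (rule degree_coeff_mult_le[OF B2]) (simp add: coeffF)
    hence "degree (f * coeff (B\<^sup>2 * F) n) \<le> degree f + (d + d)"
      using degree_mult_le[of f "coeff (B\<^sup>2 * F) n"] by linarith
    hence 2: "degree (coeff ([:f:] * (B\<^sup>2 * F)) n) < E" using deg(3) by simp
    show ?thesis unfolding coeff_diff by (rule degree_diff_less[OF 1 2])
  qed
  ultimately have "A\<^sup>2 - [:f:] * (B\<^sup>2 * F) = 0"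
    unfolding Z_def by (intro bivariate_eq_0[of _ E]) auto
  hence eq: "A\<^sup>2 = [:f:] * (B\<^sup>2 * F)" by simp
  have "B \<noteq> 0"
  proof
    assume "B = 0"
    with eq have "A = 0" by simp
    with \<open>B = 0\<close> nz show False using coeffA coeffB by (metis coeff_0)
  qed
  \<comment> \<open>Leading coefficients are taken in the outer variable. As \<open>F\<close> is
    monic there, \<open>f\<close> times a nonzero square would be a square of polynomials in X
    alone.\<close>
  have "lead_coeff F = 1"
    unfolding F_def by (subst lead_coeff_map_poly_nz) (use f in auto)
  hence "(lead_coeff A)\<^sup>2 = f * (lead_coeff B)\<^sup>2"
    using arg_cong[OF eq, of lead_coeff] by (simp add: lead_coeff_mult lead_coeff_power)
  moreover have "lead_coeff B \<noteq> 0" using \<open>B \<noteq> 0\<close> by simp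
  ultimately show False using f(2) square_of_mult_square_eq_square[of f "lead_coeff B" "lead_coeff A"]
    by metis
qed

text \<open>There are \<open>2 * U * J\<close> free coefficients in F_q, more than the relation has
  coefficients to kill. The linear algebra is done by counting: two distinct families with the same
  image are subtracted.\<close>

lemma auxiliary_polynomial_exists:
  fixes h :: "'a::{finite,field} poly" and s :: 'a
  assumes "U > 0" "J > 0" "U * M + J + degree h < 2 * U * J"
  obtains a b where "\<And>j. a j \<in> polys_lt U" "\<And>j. b j \<in> polys_lt U" "\<exists>j<J. a j \<noteq> 0 \<or> b j \<noteq> 0"
    "(\<Sum>j<J. (pcompose (a j) (monom 1 M) + smult s (pcompose (b j) (monom 1 M) * h)) * monom 1 j) = 0"
proof -
  let ?V = "polys_lt U \<times> polys_lt U :: ('a poly \<times> 'a poly) set"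
  define S where "S = ({..<J} \<rightarrow>\<^sub>E ?V)"
  define H where "H = (\<lambda>c. \<Sum>j<J. (pcompose (fst (c j)) (monom 1 M) +
      smult s (pcompose (snd (c j)) (monom 1 M) * h)) * monom 1 j)"
  define W where "W = U * M + J + degree h"
  have W: "W > 0" using \<open>J > 0\<close> by (simp add: W_def)
  have degc: "degree (pcompose p (monom 1 M)) \<le> (U - 1) * M" if "p \<in> polys_lt U" for p :: "'a poly"
  proof -
    have "degree (pcompose p (monom 1 M)) \<le> degree p * M"
      using degree_pcompose_le[of p "monom 1 M"] by (simp add: degree_monom_eq)
    also have "\<dots> \<le> (U - 1) * M"
      using that polys_lt_iff_degree[OF assms(1), of p] by (intro mult_right_mono) auto
    finally show ?thesis .
  qed
  have "H ` S \<subseteq> polys_lt W"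
  proof (intro image_subsetI)
    fix c assume c: "c \<in> S"
    have "degree (H c) < W" unfolding H_def
    proof (rule degree_sum_less[OF _ W])
      fix j assume j: "j \<in> {..<J}"
      hence cj: "fst (c j) \<in> polys_lt U" "snd (c j) \<in> polys_lt U"
        using c by (auto simp: S_def PiE_iff mem_Times_iff)
      let ?p = "pcompose (fst (c j)) (monom 1 M)" and ?r = "pcompose (snd (c j)) (monom 1 M)"
      have "degree (smult s (?r * h)) \<le> (U - 1) * M + degree h"
        using degree_smult_le[of s "?r * h"] degree_mult_le[of ?r h] degc[OF cj(2)] by linarith
      hence "degree (?p + smult s (?r * h)) \<le> (U - 1) * M + degree h"
        using degc[OF cj(1)] by (intro degree_add_le) auto
      hence "degree ((?p + smult s (?r * h)) * monom 1 j) \<le> (U - 1) * M + degree h + j"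
        using degree_mult_le[of "?p + smult s (?r * h)" "monom 1 j"] by (simp add: degree_monom_eq)
      also have "\<dots> < W"
        using j mult_right_mono[of "U - 1" U M] by (auto simp: W_def intro: add_le_less_mono)
      finally show "degree ((?p + smult s (?r * h)) * monom 1 j) < W" .
    qed
    thus "H c \<in> polys_lt W" using polys_lt_iff_degree[OF W] by blast
  qed
  hence "card (H ` S) \<le> CARD('a) ^ W"
    by (metis card_mono card_polys_lt finite_polys_lt)
  also have "\<dots> < CARD('a) ^ (2 * U * J)"
    using assms(3) card_field_gt_1[where 'a='a] by (intro power_strict_increasing) (auto simp: W_def)
  also have "\<dots> = card S"
    by (simp add: S_def card_PiE card_cartesian_product card_polys_lt flip: power_add power_mult)
       (simp add: mult_2)
  finally have "\<not> inj_on H S" using card_image by fastforce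
  then obtain c c' where cc: "c \<in> S" "c' \<in> S" "H c = H c'" "c \<noteq> c'"
    unfolding inj_on_def by blast
  from cc have "\<exists>j<J. c j \<noteq> c' j"
    unfolding S_def by (metis PiE_ext lessThan_iff)
  then obtain i where i: "i < J" "c i \<noteq> c' i" by blast
  \<comment> \<open>Zero beyond \<open>J\<close>, so that the degree bounds hold for every
    index.\<close>
  define a where "a = (\<lambda>j. if j < J then fst (c j) - fst (c' j) else 0)"
  define b where "b = (\<lambda>j. if j < J then snd (c j) - snd (c' j) else 0)"
  show ?thesis
  proof (rule that)
    have z: "0 \<in> polys_lt U" by (simp add: polys_lt_def)
    show "a j \<in> polys_lt U" for j
      using cc z by (auto simp: a_def S_def PiE_iff mem_Times_iff intro!: diff_in_polys_lt)
    show "b j \<in> polys_lt U" for j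
      using cc z by (auto simp: b_def S_def PiE_iff mem_Times_iff intro!: diff_in_polys_lt)
    show "\<exists>j<J. a j \<noteq> 0 \<or> b j \<noteq> 0"
      using i by (intro exI[of _ i]) (auto simp: a_def b_def prod_eq_iff)
    have "(\<Sum>j<J. (pcompose (a j) (monom 1 M) + smult s (pcompose (b j) (monom 1 M) * h)) * monom 1 j)
        = H c - H c'"
      unfolding H_def sum_subtractf[symmetric]
      by (intro sum.cong) (auto simp: a_def b_def pcompose_diff algebra_simps smult_diff_right)
    thus "(\<Sum>j<J. (pcompose (a j) (monom 1 M) + smult s (pcompose (b j) (monom 1 M) * h)) * monom 1 j) = 0"
      using cc(3) by simp
  qed
qed

text \<open>Both sides agree at all points of the closure, which is infinite because it contains the
  fields \<open>fixed_field k\<close> of unbounded size.\<close>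

lemma poly_frobenius_pow:
  fixes f :: "'a::{finite,field} poly"
  shows "f ^ (CARD('a) ^ k) = pcompose f (monom 1 (CARD('a) ^ k))"
proof -
  let ?p = "f ^ (CARD('a) ^ k) - pcompose f (monom 1 (CARD('a) ^ k))"
  have "eval_ac ?p x = 0" for x by (simp add: eval_ac_frobenius_pow)
  hence "{x. eval_ac ?p x = 0} = UNIV" by blast
  moreover have "infinite (UNIV :: 'a alg_closure set)"
  proof
    assume fin: "finite (UNIV :: 'a alg_closure set)"
    define n where "n = card (UNIV :: 'a alg_closure set)"
    have "n < 2 ^ Suc n" by (meson Suc_lessD less_exp)
    also have "\<dots> \<le> CARD('a) ^ Suc n"
      by (rule power_mono) (use card_field_gt_1[where 'a='a] in auto)
    also have "\<dots> = card (fixed_field (Suc n) :: 'a alg_closure set)" by (simp add: card_fixed_field)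
    also have "\<dots> \<le> n" unfolding n_def by (rule card_mono[OF fin]) simp
    finally show False by simp
  qed
  ultimately have "?p = 0" by (metis finite_eval_ac_roots)
  thus ?thesis by simp
qed

text \<open>
  On the set in question the \<open>M\<close>-th power of the auxiliary polynomial \<open>G\<close> agrees with the relation
  of the previous lemma, where \<open>x\<^sup>Q = x\<close> has been used to lower the exponents.
\<close>
lemma card_quadratic_character_eq_le:
  fixes f :: "'a::{finite,field} poly" and s :: 'a and d e :: nat
  defines "M \<equiv> CARD('a) ^ d" and "E \<equiv> CARD('a) ^ e"
  assumes "odd CARD('a)" and f: "lead_coeff f = 1" "\<nexists>l. f = l ^ 2"
    and U: "U > 0" "2 * U + degree f \<le> E + 1"
    and J: "J > 0" "U * M + J + degree f * ((M + 1) div 2) < 2 * U * J"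
  shows "card {x \<in> fixed_field (d + e). eval_ac f x = 0 \<or>
           eval_ac f x ^ ((CARD('a) ^ (d + e) - 1) div 2) = to_ac s}
         \<le> U + degree f * ((E + 1) div 2) + J * E"
proof -
  define Q where "Q = CARD('a) ^ (d + e)"
  have Q: "Q = M * E" by (simp add: Q_def M_def E_def power_add)
  have odd: "odd M" "odd E" "odd Q"
    using \<open>odd CARD('a)\<close> by (auto simp: M_def E_def Q_def)
  define h where "h = f ^ ((M + 1) div 2)"
  have f0: "f \<noteq> 0" using f(1) by auto
  have degh: "degree h = degree f * ((M + 1) div 2)"
    using f0 by (simp add: h_def degree_power_eq mult.commute)
  obtain a b where ab: "\<And>j. a j \<in> polys_lt U" "\<And>j. b j \<in> polys_lt U" "\<exists>j<J. a j \<noteq> 0 \<or> b j \<noteq> 0"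
    and rel: "(\<Sum>j<J. (pcompose (a j) (monom 1 M) + smult s (pcompose (b j) (monom 1 M) * h)) * monom 1 j) = 0"
    by (rule auxiliary_polynomial_exists[OF U(1) J(1), of M h s]) (use J(2) degh in auto)
  define G where "G = (\<Sum>j<J. (a j + b j * f ^ ((E + 1) div 2)) * monom 1 (j * E))"
  have dega: "degree (a j) \<le> U - 1" "degree (b j) \<le> U - 1" for j
    using ab(1,2)[of j] U(1) by (auto simp: polys_lt_iff_degree)
  have "G \<noteq> 0" unfolding G_def
  proof (rule auxiliary_polynomial_nonzero[OF f _ odd(2) dega _ ab(3)])
    show "f ^ E = pcompose f (monom 1 E)" unfolding E_def by (rule poly_frobenius_pow)
    show "2 * (U - 1) + degree f < E" using U by linarith
  qed
  have degG: "degree G \<le> U + degree f * ((E + 1) div 2) + J * E"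
    unfolding G_def
  proof (intro degree_sum_le)
    fix j assume j: "j \<in> {..<J}"
    let ?h = "f ^ ((E + 1) div 2)"
    have "degree (b j * ?h) \<le> (U - 1) + degree f * ((E + 1) div 2)"
      using degree_mult_le[of "b j" ?h] dega(2)[of j] f0
      by (simp add: degree_power_eq mult.commute)
    hence "degree (a j + b j * ?h) \<le> (U - 1) + degree f * ((E + 1) div 2)"
      using dega(1)[of j] by (intro degree_add_le) auto
    hence "degree ((a j + b j * ?h) * monom 1 (j * E)) \<le> (U - 1) + degree f * ((E + 1) div 2) + j * E"
      using degree_mult_le[of "a j + b j * ?h" "monom 1 (j * E)"] by (simp add: degree_monom_eq)
    also have "j * E \<le> J * E" using j by (intro mult_right_mono) auto
    finally show "degree ((a j + b j * ?h) * monom 1 (j * E)) \<le> U + degree f * ((E + 1) div 2) + J * E"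
      by linarith
  qed auto
  have "{x \<in> fixed_field (d + e). eval_ac f x = 0 \<or> eval_ac f x ^ ((Q - 1) div 2) = to_ac s}
      \<subseteq> {x. eval_ac G x = 0}"
  proof (intro subsetI CollectI)
    fix x assume x: "x \<in> {x \<in> fixed_field (d + e). eval_ac f x = 0 \<or>
        eval_ac f x ^ ((Q - 1) div 2) = to_ac s}"
    let ?y = "eval_ac f x"
    have xQ: "x ^ Q = x" using x by (simp add: fixed_field_def Q_def)
    \<comment> \<open>Since \<open>Q = M * E\<close>, raising to the power \<open>M\<close> splits
      off the exponent of Euler's criterion, whose value is prescribed on this set.\<close>
    have "(E + 1) div 2 * M = (Q - 1) div 2 + (M + 1) div 2"
    proof -
      obtain k l where "E = 2 * k + 1" "M = 2 * l + 1" using odd by (meson oddE)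
      thus ?thesis by (simp add: Q algebra_simps)
    qed
    hence "(?y ^ ((E + 1) div 2)) ^ M = ?y ^ ((Q - 1) div 2) * ?y ^ ((M + 1) div 2)"
      by (simp flip: power_mult power_add)
    \<comment> \<open>At a zero of \<open>f\<close> both sides vanish because
      \<open>(M + 1) div 2\<close> is positive. This is why zeros can be counted along with either
      sign.\<close>
    also have "\<dots> = to_ac s * ?y ^ ((M + 1) div 2)"
      using x odd_pos[OF odd(1)] by (auto simp: power_0_left)
    finally have y: "(?y ^ ((E + 1) div 2)) ^ M = to_ac s * eval_ac h x"
      by (simp add: h_def)
    have xj: "(x ^ (j * E)) ^ M = x ^ j" for j
      by (metis (no_types, opaque_lifting) Q xQ mult.assoc mult.commute power_mult)
    have evM: "eval_ac p x ^ M = eval_ac p (x ^ M)" for p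
      unfolding M_def by (rule eval_ac_frobenius_pow)
    \<comment> \<open>The power \<open>M\<close> is an iterate of the Frobenius, hence distributes
      over the sum, and \<open>xj\<close> collapses the large exponents.\<close>
    have "eval_ac G x ^ M = (\<Sum>j<J. (eval_ac (a j) x ^ M + eval_ac (b j) x ^ M * 
        (?y ^ ((E + 1) div 2)) ^ M) * (x ^ (j * E)) ^ M)"
      by (simp add: G_def M_def frobenius_pow_sum frobenius_pow_add power_mult_distrib)
    also have "\<dots> = eval_ac (\<Sum>j<J. (pcompose (a j) (monom 1 M) + 
        smult s (pcompose (b j) (monom 1 M) * h)) * monom 1 j) x"
      unfolding y xj evM by (simp add: mult.left_commute)
    also have "\<dots> = 0" unfolding rel by simp
    finally show "eval_ac G x = 0" by (metis power_not_zero)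
  qed
  hence "card {x \<in> fixed_field (d + e). eval_ac f x = 0 \<or> eval_ac f x ^ ((Q - 1) div 2) = to_ac s}
      \<le> card {x. eval_ac G x = 0}"
    by (intro card_mono finite_eval_ac_roots \<open>G \<noteq> 0\<close>)
  also have "\<dots> \<le> degree G" by (rule card_eval_ac_roots_le[OF \<open>G \<noteq> 0\<close>])
  finally show ?thesis using degG unfolding Q_def by linarith
qed

section \<open>The quadratic character\<close>

text \<open>Euler's criterion for the field with \<open>q ^ k\<close> elements. The value is
  meaningful only on \<open>fixed_field k\<close>.\<close>

definition quad_char :: "nat \<Rightarrow> 'a::{finite,field} alg_closure \<Rightarrow> int" where
  "quad_char k x = (if x = 0 then 0 else if x ^ ((CARD('a) ^ k - 1) div 2) = 1 then 1 else -1)"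

lemma fixed_field_0 [simp]: "0 \<in> fixed_field k"
  by (simp add: fixed_field_def power_0_left)

lemma fixed_field_to_ac [simp]: "to_ac c \<in> fixed_field k"
  by (simp add: fixed_field_def to_ac_frobenius_pow)

lemma fixed_field_add: "x \<in> fixed_field k \<Longrightarrow> y \<in> fixed_field k \<Longrightarrow> x + y \<in> fixed_field k"
  by (simp add: fixed_field_def frobenius_pow_add)

lemma fixed_field_mult: "x \<in> fixed_field k \<Longrightarrow> y \<in> fixed_field k \<Longrightarrow> x * y \<in> fixed_field k"
  by (simp add: fixed_field_def power_mult_distrib)

lemma fixed_field_divide: "x \<in> fixed_field k \<Longrightarrow> y \<in> fixed_field k \<Longrightarrow> x / y \<in> fixed_field k"
  by (simp add: fixed_field_def power_divide)

lemma fixed_field_eval_ac: "x \<in> fixed_field k \<Longrightarrow> eval_ac p x \<in> fixed_field k"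
  by (simp add: fixed_field_def eval_ac_frobenius_pow)

lemma fixed_field_frobenius_pow:
  fixes x :: "'a::{finite,field} alg_closure"
  shows "x \<in> fixed_field k \<Longrightarrow> x ^ (CARD('a) ^ i) \<in> fixed_field k"
  by (simp add: fixed_field_def) (metis power_commutes power_mult mult.commute)

context
  fixes Q :: nat and k :: nat
  assumes odd_card: "odd CARD('a::{finite,field})" and k: "k > 0"
  defines "Q \<equiv> CARD('a) ^ k"
begin

lemma odd_Q: "odd Q" and Q_ge_3: "Q \<ge> 3"
proof -
  show "odd Q" using odd_card by (simp add: Q_def)
  moreover have "Q > 1" unfolding Q_def by (rule card_power_gt_1[OF k])
  ultimately show "Q \<ge> 3" by presburger
qed

lemma mult_power_pred_Q: "x * x ^ (Q - 1) = (x :: 'b::monoid_mult) ^ Q"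
  using Q_ge_3 by (cases Q) auto

lemma power_half_square: "(x ^ ((Q - 1) div 2))\<^sup>2 = (x :: 'b::monoid_mult) ^ (Q - 1)"
proof -
  have "(Q - 1) div 2 * 2 = Q - 1" using odd_Q by (intro dvd_div_mult_self) simp
  thus ?thesis unfolding power_mult[symmetric] by simp
qed

text \<open>In odd characteristic the three signs stay distinct, so identities between powers in the
  closure can be read back as identities of integers.\<close>

lemma of_int_sign_inj:
  assumes "a \<in> {-1, 0, 1}" "b \<in> {-1, 0, 1}" "of_int a = (of_int b :: 'a alg_closure)"
  shows "a = b"
  using assms one_neq_minus_one[OF odd_card] one_neq_minus_one[OF odd_card, symmetric]
  by (elim insertE emptyE) simp_all

lemma quad_char_cases: "quad_char k (x :: 'a alg_closure) \<in> {-1, 0, 1}"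
  by (simp add: quad_char_def)

lemma power_half_cases:
  fixes x :: "'a alg_closure"
  assumes "x \<in> fixed_field k" "x \<noteq> 0"
  shows "x ^ ((Q - 1) div 2) = 1 \<or> x ^ ((Q - 1) div 2) = -1"
proof -
  have "x * x ^ (Q - 1) = x * 1"
    unfolding mult_power_pred_Q mult_1_right
    using assms(1) unfolding fixed_field_def Q_def mem_Collect_eq .
  hence "x ^ (Q - 1) = 1" using assms(2) by (simp only: mult_cancel_left) simp
  moreover have "x ^ (Q - 1) = (x ^ ((Q - 1) div 2))\<^sup>2"
    by (rule power_half_square[symmetric])
  ultimately show ?thesis by (simp add: power2_eq_1_iff)
qed

lemma of_int_quad_char:
  assumes "x \<in> fixed_field k"
  shows "of_int (quad_char k x) = (x :: 'a alg_closure) ^ ((Q - 1) div 2)"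
proof (cases "x = 0")
  case True
  thus ?thesis using Q_ge_3 by (simp add: quad_char_def power_0_left)
next
  case False
  thus ?thesis using power_half_cases[OF assms False] by (auto simp: quad_char_def Q_def)
qed

lemma quad_char_eqI:
  assumes "x \<in> fixed_field k" "n \<in> {-1, 0, 1}" "(x :: 'a alg_closure) ^ ((Q - 1) div 2) = of_int n"
  shows "quad_char k x = n"
  using of_int_sign_inj[OF quad_char_cases assms(2)] of_int_quad_char[OF assms(1)] assms(3) by metis

lemma quad_char_mult:
  assumes "x \<in> fixed_field k" "y \<in> fixed_field k"
  shows "quad_char k (x * y) = quad_char k x * quad_char k (y :: 'a alg_closure)"
proof (rule quad_char_eqI)
  show "quad_char k x * quad_char k y \<in> {-1, 0, 1}"
    using quad_char_cases[of x] quad_char_cases[of y] by auto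
  show "(x * y) ^ ((Q - 1) div 2) = of_int (quad_char k x * quad_char k y)"
    using assms by (simp add: of_int_quad_char power_mult_distrib)
qed (intro fixed_field_mult assms)

lemma quad_char_1 [simp]: "quad_char k (1 :: 'a alg_closure) = 1"
  by (simp add: quad_char_def)

text \<open>A square root \<open>y\<close> exists in the closure, and \<open>y ^ (Q - 1)\<close>
  equals \<open>x ^ ((Q - 1) div 2)\<close>, so Euler's criterion says exactly that \<open>y\<close>
  lies in the subfield.\<close>

lemma quad_char_eq_1_iff:
  assumes "x \<in> fixed_field k" "x \<noteq> (0 :: 'a alg_closure)"
  shows "quad_char k x = 1 \<longleftrightarrow> (\<exists>y\<in>fixed_field k. y\<^sup>2 = x)"
proof -
  obtain y where y: "y\<^sup>2 = x" using nth_root_exists[of 2 x] by auto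
  hence "y \<noteq> 0" using assms by auto
  have pow: "z\<^sup>2 ^ ((Q - 1) div 2) = z ^ (Q - 1)" for z :: "'a alg_closure"
    unfolding power_half_square[symmetric] power_mult[symmetric] by (simp add: mult.commute)
  have fix_iff: "z \<in> fixed_field k \<longleftrightarrow> z ^ (Q - 1) = 1" if "z \<noteq> 0" for z :: "'a alg_closure"
  proof -
    have "z ^ Q = z * z ^ (Q - 1)" by (rule mult_power_pred_Q[symmetric])
    thus ?thesis using that by (simp add: fixed_field_def Q_def)
  qed
  have 1: "quad_char k x = 1 \<longleftrightarrow> x ^ ((Q - 1) div 2) = 1"
    using assms(2) by (simp add: quad_char_def Q_def)
  show ?thesis
  proof
    assume "quad_char k x = 1"
    hence "y \<in> fixed_field k" using 1 pow[of y] y fix_iff[OF \<open>y \<noteq> 0\<close>] by simp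
    thus "\<exists>y\<in>fixed_field k. y\<^sup>2 = x" using y by blast
  next
    assume "\<exists>y\<in>fixed_field k. y\<^sup>2 = x"
    then obtain z where z: "z \<in> fixed_field k" "z\<^sup>2 = x" by blast
    with assms(2) have "z \<noteq> 0" by auto
    thus "quad_char k x = 1" using 1 pow[of z] z fix_iff by simp
  qed
qed

text \<open>Multiplication by a non-square permutes the field and negates the sum. A non-square
  exists because \<open>X ^ ((Q - 1) div 2) - 1\<close> has fewer than \<open>Q - 1\<close>
  roots.\<close>

lemma sum_quad_char: "(\<Sum>x\<in>fixed_field k. quad_char k (x :: 'a alg_closure)) = 0"
proof -
  let ?F = "fixed_field k :: 'a alg_closure set" and ?h = "(Q - 1) div 2"
  have h: "?h > 0" "?h < Q - 1" using Q_ge_3 by auto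
  have "\<exists>c\<in>?F. c \<noteq> 0 \<and> quad_char k c \<noteq> 1"
  proof (rule ccontr)
    assume *: "\<not> (\<exists>c\<in>?F. c \<noteq> 0 \<and> quad_char k c \<noteq> 1)"
    let ?p = "monom 1 ?h - 1 :: 'a alg_closure poly"
    have "degree ?p \<le> ?h" by (intro degree_diff_le) (auto simp: degree_monom_le)
    moreover have "card (?F - {0}) = Q - 1"
      using k by (simp add: card_Diff_singleton card_fixed_field Q_def finite_fixed_field)
    moreover have "poly ?p x = 0" if "x \<in> ?F - {0}" for x
      using that * of_int_quad_char[of x] by (auto simp: poly_monom)
    ultimately have "?p = 0"
      using h by (intro poly_eq_0_of_card_roots[of "?F - {0}"]) (auto simp only: intro: le_less_trans)
    hence "coeff ?p ?h = 0" by simp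
    thus False using h by (simp add: coeff_eq_0)
  qed
  then obtain c where c: "c \<in> ?F" "c \<noteq> 0" "quad_char k c \<noteq> 1" by blast
  hence cm: "quad_char k c = -1" by (auto simp: quad_char_def split: if_splits)
  have "bij_betw (\<lambda>x. c * x) ?F ?F"
    by (rule bij_betwI[where g = "\<lambda>x. x / c"])
       (use c in \<open>auto intro: fixed_field_mult fixed_field_divide\<close>)
  hence "(\<Sum>x\<in>?F. quad_char k (c * x)) = (\<Sum>x\<in>?F. quad_char k x)"
    by (rule sum.reindex_bij_betw)
  moreover have "(\<Sum>x\<in>?F. quad_char k (c * x)) = - (\<Sum>x\<in>?F. quad_char k x)"
    unfolding sum_negf[symmetric] by (intro sum.cong) (auto simp: quad_char_mult c cm)
  ultimately show ?thesis by simp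
qed

lemma abs_sum_quad_char_le_of_card_le:
  fixes f :: "'a poly"
  assumes B: "\<And>s. s \<in> {1, -1 :: 'a} \<Longrightarrow> card {x \<in> fixed_field k. eval_ac f x = 0 \<or>
      eval_ac f x ^ ((CARD('a) ^ k - 1) div 2) = to_ac s} \<le> B"
  shows "\<bar>\<Sum>x\<in>fixed_field k. quad_char k (eval_ac f x)\<bar> \<le> 2 * int B - int (CARD('a) ^ k)"
proof -
  let ?F = "fixed_field k :: 'a alg_closure set"
  have fin: "finite ?F" by (rule finite_fixed_field[OF k])
  define T where "T = (\<lambda>s. {x \<in> ?F. eval_ac f x = 0 \<or> quad_char k (eval_ac f x) = s})"
  have sub: "int (card (T s)) \<le> int B" if s: "s \<in> {1, -1}" for s
  proof -
    have "T s \<subseteq> {x \<in> ?F. eval_ac f x = 0 \<or>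
        eval_ac f x ^ ((CARD('a) ^ k - 1) div 2) = to_ac (of_int s)}"
      unfolding T_def using of_int_quad_char[OF fixed_field_eval_ac[of _ k f]] by (auto simp: Q_def)
    hence "card (T s) \<le> card {x \<in> ?F. eval_ac f x = 0 \<or>
        eval_ac f x ^ ((CARD('a) ^ k - 1) div 2) = to_ac (of_int s)}"
      by (intro card_mono) (use fin in auto)
    also have "\<dots> \<le> B" using s by (intro B) auto
    finally show ?thesis by simp
  qed
  have cardT: "int (card (T s)) = (\<Sum>x\<in>?F. of_bool (eval_ac f x = 0 \<or> quad_char k (eval_ac f x) = s))" for s
    unfolding T_def using fin by (simp add: of_bool_def sum.If_cases Int_def)
  have "s * (\<Sum>x\<in>?F. quad_char k (eval_ac f x)) \<le> 2 * int (card (T s)) - int (card ?F)"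
    if s: "s \<in> {1, -1}" for s
  proof -
    have "s * (\<Sum>x\<in>?F. quad_char k (eval_ac f x)) + int (card ?F)
        = (\<Sum>x\<in>?F. s * quad_char k (eval_ac f x) + 1)"
      by (simp add: sum.distrib sum_distrib_left)
    \<comment> \<open>The summand on the left is 1, 2 or 0 according as the character vanishes,
      equals \<open>s\<close> or equals \<open>- s\<close>.\<close>
    also have "\<dots> \<le> (\<Sum>x\<in>?F. 2 * of_bool (eval_ac f x = 0 \<or> quad_char k (eval_ac f x) = s))"
      by (rule sum_mono) (use s in \<open>auto simp: quad_char_def\<close>)
    finally show ?thesis by (simp add: cardT sum_distrib_left)
  qed
  from this[of 1] this[of "-1"] sub[of 1] sub[of "-1"] show ?thesis
    by (simp add: card_fixed_field[OF k])
qed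

end

text \<open>Bounds of this kind are due to Weil; the proof is the elementary one of Stepanov and Bombieri.\<close>
lemma abs_sum_quad_char_eval_le:
  fixes f :: "'a::{finite,field} poly" and d e :: nat
  defines "E \<equiv> CARD('a) ^ e"
  assumes odd: "odd CARD('a)" and f: "lead_coeff f = 1" "\<nexists>l. f = l ^ 2"
    and "d \<le> e" and E: "E \<ge> 5" "E \<ge> 4 * degree f"
  shows "\<bar>\<Sum>x\<in>fixed_field (d + e). quad_char (d + e) (eval_ac f x)\<bar> \<le> 6 * (degree f + 1) * E"
proof -
  define M where "M = CARD('a) ^ d"
  define m where "m = degree f"
  have "M \<le> E" unfolding M_def E_def by (rule power_increasing) (use \<open>d \<le> e\<close> in auto)
  have "odd M" "odd E" using odd by (simp_all add: M_def E_def)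
  then obtain r t where r: "M = 2 * r + 1" and t: "E = 2 * t + 1" by (meson oddE)
  have "e > 0" using E(1) unfolding E_def by (cases e) auto
  \<comment> \<open>Up to rounding, \<open>U\<close> is as large as the nonvanishing of the
    auxiliary polynomial permits. The first summand of \<open>J\<close> is
    \<open>(M + 1) / 2\<close>, which balances \<open>U * M\<close> against
    \<open>2 * U * J\<close>; the second leaves room for the remaining terms.\<close>
  define U where "U = (E - m) div 2"
  define J where "J = (r + 1) + 2 * (m + 1)"
  have U: "2 * U + m \<le> E" "E \<le> 2 * U + m + 1" using E by (auto simp: U_def m_def)
  have U0: "U > 0" using U E unfolding m_def by linarith
  \<comment> \<open>From \<open>4 * m \<le> E\<close> follows
    \<open>4 * U \<ge> 3 * E / 2 - 2\<close>, while \<open>r + 3\<close> is at most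
    \<open>(E + 5) / 2\<close>; \<open>E \<ge> 5\<close> closes the gap.\<close>
  have rU: "r + 3 \<le> 4 * U" using U E \<open>M \<le> E\<close> r unfolding m_def by linarith
  have "(m + 1) * (r + 3) \<le> (m + 1) * (4 * U)" using rU by (rule mult_left_mono) simp
  hence "U * M + J + m * ((M + 1) div 2) < 2 * U * J"
    using U0 by (simp add: J_def r algebra_simps)
  hence "card {x \<in> fixed_field (d + e). eval_ac f x = 0 \<or>
      eval_ac f x ^ ((CARD('a) ^ (d + e) - 1) div 2) = to_ac s} \<le> U + m * (t + 1) + J * E" for s
    using card_quadratic_character_eq_le[OF odd f U0, of e J d s] U 
    unfolding m_def M_def[symmetric] E_def[symmetric] by (simp add: J_def t)
  hence "\<bar>\<Sum>x\<in>fixed_field (d + e). quad_char (d + e) (eval_ac f x)\<bar>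
      \<le> 2 * int (U + m * (t + 1) + J * E) - int (CARD('a) ^ (d + e))"
    using \<open>e > 0\<close> by (intro abs_sum_quad_char_le_of_card_le odd) auto
  also have "CARD('a) ^ (d + e) = M * E" by (simp add: M_def E_def power_add)
  \<comment> \<open>The summand \<open>(M + 1) / 2\<close> of \<open>J\<close> produces
    \<open>M * E\<close>, which cancels the size of the field. What is left is bounded by a multiple
    of \<open>E\<close>.\<close>
  also have "2 * int (U + m * (t + 1) + J * E) - int (M * E) \<le> int (6 * (m + 1) * E)"
  proof -
    have "2 * (U + m * (t + 1) + J * E) \<le> M * E + 6 * (m + 1) * E"
    proof -
      have "2 * (U + m * (t + 1) + J * E) = 2 * U + m * (E + 1) + M * E + E + 4 * (m + 1) * E"
        by (simp add: J_def r t algebra_simps)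
      also have "\<dots> \<le> E + m * (E + E) + M * E + E + 4 * (m + 1) * E"
        using U E by (intro add_mono mult_left_mono) auto
      also have "\<dots> = M * E + 6 * (m + 1) * E" by (simp add: algebra_simps)
      finally show ?thesis .
    qed
    thus ?thesis by (simp only: of_nat_mult of_nat_add flip: of_nat_le_iff[where 'a=int])
  qed
  finally show ?thesis by (simp add: m_def)
qed

section \<open>Conjugates and irreducible polynomials\<close>

text \<open>For \<open>n > 0\<close> these are the elements of degree exactly \<open>n\<close> over
  F_q. The index \<open>d = 0\<close> is excluded because \<open>fixed_field 0\<close> is
  everything.\<close>

definition primitive_elements :: "nat \<Rightarrow> 'a::{finite,field} alg_closure set" where
  "primitive_elements n = {x \<in> fixed_field n. \<forall>d. 0 < d \<and> d < n \<longrightarrow> x \<notin> fixed_field d}"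

lemma primitive_elements_period:
  assumes "x \<in> fixed_field n" "n > 0"
  obtains d where "d > 0" "x \<in> primitive_elements d"
proof
  let ?P = "\<lambda>d. d > 0 \<and> x \<in> fixed_field d"
  have *: "?P (LEAST d. ?P d)" by (rule LeastI[of ?P n]) (use assms in simp)
  thus "(LEAST d. ?P d) > 0" by simp
  show "x \<in> primitive_elements (LEAST d. ?P d)"
    using * not_less_Least[of _ ?P] by (auto simp: primitive_elements_def)
qed

text \<open>If two conjugates coincide, injectivity of the Frobenius cancels the common power and
  puts \<open>x\<close> into a smaller fixed field.\<close>

lemma inj_on_conjugates:
  fixes x :: "'a::{finite,field} alg_closure"
  assumes "x \<in> primitive_elements n"
  shows "inj_on (\<lambda>i. x ^ (CARD('a) ^ i)) {..<n}"
proof (rule linorder_inj_onI)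
  fix i j assume ij: "i < j" "i \<in> {..<n}" "j \<in> {..<n}"
  show "x ^ (CARD('a) ^ i) \<noteq> x ^ (CARD('a) ^ j)"
  proof
    assume eq: "x ^ (CARD('a) ^ i) = x ^ (CARD('a) ^ j)"
    have "CARD('a) ^ j = CARD('a) ^ (j - i) * CARD('a) ^ i"
      using ij by (simp flip: power_add)
    hence "(x ^ (CARD('a) ^ (j - i))) ^ (CARD('a) ^ i) = x ^ (CARD('a) ^ i)"
      using eq by (simp flip: power_mult)
    hence "x ^ (CARD('a) ^ (j - i)) = x" by (rule frobenius_pow_inj)
    hence "x \<in> fixed_field (j - i)" by (simp add: fixed_field_def)
    thus False using assms ij by (auto simp: primitive_elements_def)
  qed
qed auto

lemma card_conjugates:
  fixes x :: "'a::{finite,field} alg_closure"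
  assumes "x \<in> primitive_elements n"
  shows "card ((\<lambda>i. x ^ (CARD('a) ^ i)) ` {..<n}) = n"
  using card_image[OF inj_on_conjugates[OF assms]] by simp

lemma eval_ac_conjugate:
  fixes x :: "'a::{finite,field} alg_closure"
  assumes "eval_ac p x = 0"
  shows "eval_ac p (x ^ (CARD('a) ^ i)) = 0"
  using eval_ac_frobenius_pow[of p x i] assms by (simp add: power_0_left)

text \<open>A polynomial over F_q vanishing at \<open>x\<close> also vanishes at its
  \<open>n\<close> distinct conjugates.\<close>

lemma degree_ge_of_eval_ac_eq_0:
  fixes x :: "'a::{finite,field} alg_closure"
  assumes "x \<in> primitive_elements n" "eval_ac p x = 0" "p \<noteq> 0"
  shows "n \<le> degree p"
proof -
  have "n = card ((\<lambda>i. x ^ (CARD('a) ^ i)) ` {..<n})"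
    by (rule card_conjugates[OF assms(1), symmetric])
  also have "\<dots> \<le> card {z. eval_ac p z = 0}"
    by (rule card_mono[OF finite_eval_ac_roots[OF assms(3)]]) (auto intro: eval_ac_conjugate[OF assms(2)])
  also have "\<dots> \<le> degree p" by (rule card_eval_ac_roots_le[OF assms(3)])
  finally show ?thesis .
qed

text \<open>This is the minimal polynomial, found by pigeonhole: \<open>q ^ (n + 1)\<close>
  polynomials of degree at most \<open>n\<close> take values in a field of \<open>q ^ n\<close>
  elements. A factor vanishing at \<open>x\<close> has degree at least \<open>n\<close>, which
  forces irreducibility.\<close>

lemma exists_monic_prime_of_primitive:
  fixes x :: "'a::{finite,field} alg_closure"
  assumes x: "x \<in> primitive_elements n" and n: "n > 0"
  shows "\<exists>p\<in>monic_primes n. eval_ac p x = 0"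
proof -
  have "(\<lambda>p. eval_ac p x) ` (polys_lt (Suc n) :: 'a poly set) \<subseteq> fixed_field n"
    using x by (auto simp: primitive_elements_def intro: fixed_field_eval_ac)
  hence "card ((\<lambda>p. eval_ac p x) ` (polys_lt (Suc n) :: 'a poly set)) \<le> CARD('a) ^ n"
    using card_mono[OF finite_fixed_field[OF n]] by (metis card_fixed_field[OF n])
  also have "\<dots> < CARD('a) ^ Suc n" using card_field_gt_1[where 'a='a] by simp
  also have "\<dots> = card (polys_lt (Suc n) :: 'a poly set)" by (rule card_polys_lt[symmetric])
  finally have "\<not> inj_on (\<lambda>p. eval_ac p x) (polys_lt (Suc n) :: 'a poly set)"
    using card_image by fastforce
  then obtain p r :: "'a poly" where pr: "p \<in> polys_lt (Suc n)" "r \<in> polys_lt (Suc n)" "p \<noteq> r"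
      "eval_ac p x = eval_ac r x"
    unfolding inj_on_def by blast
  define u where "u = p - r"
  have u: "u \<noteq> 0" "eval_ac u x = 0" using pr by (auto simp: u_def)
  have "u \<in> polys_lt (Suc n)" unfolding u_def by (rule diff_in_polys_lt[OF pr(1,2)])
  hence "degree u \<le> n" using polys_lt_iff_degree[of "Suc n" u] by simp
  hence degu: "degree u = n" using degree_ge_of_eval_ac_eq_0[OF x u(2,1)] by simp
  define m where "m = smult (inverse (lead_coeff u)) u"
  have m: "lead_coeff m = 1" "degree m = n" "eval_ac m x = 0"
    using u degu by (auto simp: m_def)
  have m0: "m \<noteq> 0" using m(1) by auto
  have "irreducible m"
  proof (rule irreducibleI)
    show "m \<noteq> 0" by (rule m0)
    show "\<not> is_unit m" using m n m0 by (simp add: is_unit_iff_degree)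
    fix a b assume ab: "m = a * b"
    with m0 have ab0: "a \<noteq> 0" "b \<noteq> 0" by auto
    have deg: "degree a + degree b = n" using m(2) ab ab0 by (simp add: degree_mult_eq)
    have "eval_ac a x = 0 \<or> eval_ac b x = 0" using m(3) ab by simp
    hence "n \<le> degree a \<or> n \<le> degree b"
      using degree_ge_of_eval_ac_eq_0[OF x] ab0 by blast
    hence "degree a = 0 \<or> degree b = 0" using deg by linarith
    thus "is_unit a \<or> is_unit b" using ab0 by (simp add: is_unit_iff_degree)
  qed
  with m show ?thesis unfolding monic_primes_def by blast
qed

lemma root_in_fixed_field:
  fixes x :: "'a::{finite,field} alg_closure"
  assumes "p \<noteq> 0" "eval_ac p x = 0"
  obtains d where "d > 0" "x \<in> fixed_field d"
proof -
  have "range (\<lambda>i. x ^ (CARD('a) ^ i)) \<subseteq> {z. eval_ac p z = 0}"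
    by (auto intro: eval_ac_conjugate[OF assms(2)])
  hence "finite (range (\<lambda>i. x ^ (CARD('a) ^ i)))"
    by (rule finite_subset) (rule finite_eval_ac_roots[OF assms(1)])
  hence "\<not> inj (\<lambda>i::nat. x ^ (CARD('a) ^ i))" using finite_imageD by blast
  then obtain i j :: nat where ij: "i < j" "x ^ (CARD('a) ^ i) = x ^ (CARD('a) ^ j)"
    unfolding inj_on_def by (metis linorder_neqE_nat)
  have "CARD('a) ^ j = CARD('a) ^ (j - i) * CARD('a) ^ i"
    using ij by (simp flip: power_add)
  hence "(x ^ (CARD('a) ^ (j - i))) ^ (CARD('a) ^ i) = x ^ (CARD('a) ^ i)"
    using ij by (simp flip: power_mult)
  hence "x ^ (CARD('a) ^ (j - i)) = x" by (rule frobenius_pow_inj)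
  thus ?thesis using ij that[of "j - i"] by (simp add: fixed_field_def)
qed

section \<open>Monic primes and their roots\<close>

lemma monic_irreducible_eq_of_dvd:
  fixes p r :: "'b::field poly"
  assumes "irreducible p" "irreducible r" "lead_coeff p = 1" "lead_coeff r = 1" "p dvd r"
  shows "p = r"
proof -
  obtain c where c: "r = p * c" using assms(5) by (elim dvdE)
  have "\<not> is_unit p" using assms(1) by (simp add: irreducible_def)
  hence "is_unit c" using assms(2) c unfolding irreducible_def by blast
  then obtain a where "c = [:a:]" by (auto elim: is_unit_polyE)
  moreover have "lead_coeff c = 1" using assms(3,4) c by (simp add: lead_coeff_mult)
  ultimately show ?thesis using c by simp
qed

lemma monic_primes_pos: "P \<in> monic_primes n \<Longrightarrow> n > 0"
  by (auto simp: monic_primes_def irreducible_def is_unit_iff_degree intro!: Nat.gr0I)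

lemma monic_prime_neq_0: "P \<in> monic_primes n \<Longrightarrow> P \<noteq> 0"
  by (auto simp: monic_primes_def)

lemma finite_monics [simp]: "finite (monics n :: 'a::{finite,field} poly set)"
  by (rule finite_subset[OF _ finite_polys_lt[of "Suc n"]])
     (auto simp: monics_def polys_lt_def coeff_eq_0)

lemma finite_monic_primes [simp]: "finite (monic_primes n :: 'a::{finite,field} poly set)"
  by (rule finite_subset[OF _ finite_monics[of n]]) (auto simp: monics_def monic_primes_def)

lemma monic_prime_root:
  fixes P :: "'a::{finite,field} poly"
  assumes "P \<in> monic_primes n"
  obtains x where "eval_ac P x = 0"
  using alg_closed_imp_poly_has_root[of "map_poly to_ac P"] monic_primes_pos[OF assms] assms
  by (auto simp: monic_primes_def eval_ac_def)

text \<open>The minimal polynomial \<open>R\<close> of \<open>x\<close> divides everything that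
  vanishes at \<open>x\<close>, in particular \<open>P\<close>. Both are monic and irreducible,
  hence equal, and the degree of \<open>x\<close> is that of \<open>P\<close>.\<close>

lemma
  fixes P :: "'a::{finite,field} poly"
  assumes P: "P \<in> monic_primes n" and x: "eval_ac P x = 0"
  shows monic_prime_root_primitive: "x \<in> primitive_elements n"
    and monic_prime_dvd_iff: "P dvd p \<longleftrightarrow> eval_ac p x = 0"
proof -
  have P0: "P \<noteq> 0" by (rule monic_prime_neq_0[OF P])
  obtain e where "e > 0" "x \<in> fixed_field e"
    by (rule root_in_fixed_field[OF P0 x])
  then obtain d where d: "d > 0" "x \<in> primitive_elements d" by (blast elim: primitive_elements_period)
  have dvd: "R dvd p" if R: "R \<in> monic_primes d" "eval_ac R x = 0" and p: "eval_ac p x = 0" for R p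
  proof -
    have "R \<noteq> 0" by (rule monic_prime_neq_0[OF R(1)])
    have "degree R = d" using R(1) by (simp add: monic_primes_def)
    have "eval_ac (p mod R) x = 0"
      using p R(2) div_mult_mod_eq[of p R] by (metis add_0 eval_ac_add eval_ac_mult mult_zero_right)
    moreover have "p mod R = 0 \<or> degree (p mod R) < d"
      using degree_mod_less[OF \<open>R \<noteq> 0\<close>, of p] \<open>degree R = d\<close> by auto
    ultimately have "p mod R = 0" using degree_ge_of_eval_ac_eq_0[OF d(2)] by force
    thus ?thesis by (rule mod_0_imp_dvd)
  qed
  obtain R where R: "R \<in> monic_primes d" "eval_ac R x = 0"
    using exists_monic_prime_of_primitive[OF d(2,1)] by blast
  have "R = P"
    by (rule monic_irreducible_eq_of_dvd)
       (use P R dvd[OF R x] in \<open>auto simp: monic_primes_def\<close>)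
  hence "d = n" using P R by (auto simp: monic_primes_def)
  thus "x \<in> primitive_elements n" using d by simp
  show "P dvd p \<longleftrightarrow> eval_ac p x = 0"
    using dvd[of P p] R \<open>R = P\<close> x by (auto elim!: dvdE)
qed

lemma monic_prime_roots:
  fixes P :: "'a::{finite,field} poly"
  assumes P: "P \<in> monic_primes n" and x: "eval_ac P x = 0"
  shows "{z. eval_ac P z = 0} = (\<lambda>i. x ^ (CARD('a) ^ i)) ` {..<n}"
proof (rule sym, rule card_subset_eq)
  have P0: "P \<noteq> 0" by (rule monic_prime_neq_0[OF P])
  show "finite {z. eval_ac P z = 0}" by (rule finite_eval_ac_roots[OF P0])
  show sub: "(\<lambda>i. x ^ (CARD('a) ^ i)) ` {..<n} \<subseteq> {z. eval_ac P z = 0}"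
    by (auto intro: eval_ac_conjugate[OF x])
  have "card ((\<lambda>i. x ^ (CARD('a) ^ i)) ` {..<n}) = n"
    by (rule card_conjugates[OF monic_prime_root_primitive[OF P x]])
  moreover have "card {z. eval_ac P z = 0} \<le> n"
    using card_eval_ac_roots_le[OF P0] P by (simp add: monic_primes_def)
  moreover have "card ((\<lambda>i. x ^ (CARD('a) ^ i)) ` {..<n}) \<le> card {z. eval_ac P z = 0}"
    by (rule card_mono[OF finite_eval_ac_roots[OF P0] sub])
  ultimately show "card ((\<lambda>i. x ^ (CARD('a) ^ i)) ` {..<n}) = card {z. eval_ac P z = 0}" by simp
qed

text \<open>Two monic polynomials of degree \<open>n\<close> that agree at the \<open>n\<close>
  conjugates are equal. This splitting lets reciprocity be computed as a resultant.\<close>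

lemma eval_ac_monic_prime_eq_prod:
  fixes P :: "'a::{finite,field} poly"
  assumes P: "P \<in> monic_primes n" and x: "eval_ac P x = 0"
  shows "eval_ac P y = (\<Prod>i<n. y - x ^ (CARD('a) ^ i))"
proof -
  let ?R = "\<Prod>i<n. [:- (x ^ (CARD('a) ^ i)), 1:]"
  let ?S = "(\<lambda>i. x ^ (CARD('a) ^ i)) ` {..<n}"
  have n: "n > 0" by (rule monic_primes_pos[OF P])
  have degR: "degree ?R = n" by (subst degree_prod_eq_sum_degree) auto
  have lcR: "lead_coeff ?R = 1" by (subst lead_coeff_prod) auto
  have degP: "degree (map_poly to_ac P) = n" "lead_coeff (map_poly to_ac P) = 1"
    using P by (auto simp: monic_primes_def coeff_map_poly)
  have "map_poly to_ac P - ?R = 0"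
  proof (rule poly_eq_0_of_card_roots[of ?S])
    show "degree (map_poly to_ac P - ?R) < card ?S"
      unfolding card_conjugates[OF monic_prime_root_primitive[OF P x]]
    proof (rule degree_lessI)
      show "map_poly to_ac P - ?R \<noteq> 0 \<or> n > 0" using n by simp
      show "\<forall>k\<ge>n. coeff (map_poly to_ac P - ?R) k = 0"
      proof (intro allI impI)
        fix k assume "k \<ge> n"
        thus "coeff (map_poly to_ac P - ?R) k = 0"
          using degP lcR degR by (cases "k = n") (auto simp: coeff_eq_0)
      qed
    qed
    fix z assume "z \<in> ?S"
    moreover from this have "poly (map_poly to_ac P) z = 0"
      using monic_prime_roots[OF P x] by (auto simp: eval_ac_def)
    ultimately show "poly (map_poly to_ac P - ?R) z = 0"
      by (auto simp: poly_prod)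
  qed
  hence "map_poly to_ac P = ?R" by simp
  thus ?thesis by (simp add: eval_ac_def poly_prod)
qed

text \<open>The choice of the root is immaterial wherever the summed function is invariant under the
  Frobenius.\<close>

definition root_ac :: "'a::{finite,field} poly \<Rightarrow> 'a alg_closure" where
  "root_ac P = (SOME x. eval_ac P x = 0)"

lemma eval_ac_root_ac: "P \<in> monic_primes n \<Longrightarrow> eval_ac P (root_ac P) = 0"
  unfolding root_ac_def by (rule someI_ex) (blast elim: monic_prime_root)

lemma root_ac_in_fixed_field: "P \<in> monic_primes n \<Longrightarrow> root_ac P \<in> fixed_field n"
  using monic_prime_root_primitive[OF _ eval_ac_root_ac] by (auto simp: primitive_elements_def)

text \<open>The root sets of the primes of degree \<open>n\<close> are the Frobenius orbits of the
  primitive elements, each of size \<open>n\<close>, and \<open>h\<close> is constant on each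
  orbit.\<close>

lemma sum_monic_primes_eq_sum_primitive:
  fixes h :: "'a::{finite,field} alg_closure \<Rightarrow> int"
  assumes n: "n > 0" and h: "\<And>x. x \<in> fixed_field n \<Longrightarrow> h (x ^ CARD('a)) = h x"
  shows "int n * (\<Sum>P\<in>monic_primes n. h (root_ac P)) = (\<Sum>x\<in>primitive_elements n. h x)"
proof -
  let ?Z = "\<lambda>P :: 'a poly. {z. eval_ac P z = 0}"
  have hpow: "h (x ^ (CARD('a) ^ i)) = h x" if "x \<in> fixed_field n" for x i
  proof (induction i)
    case (Suc i)
    have "h ((x ^ (CARD('a) ^ i)) ^ CARD('a)) = h (x ^ (CARD('a) ^ i))"
      by (rule h[OF fixed_field_frobenius_pow[OF that]])
    thus ?case using Suc by (simp add: mult.commute flip: power_mult)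
  qed simp
  have "(\<Sum>x\<in>?Z P. h x) = int n * h (root_ac P)" if P: "P \<in> monic_primes n" for P
  proof -
    let ?r = "root_ac P"
    have r: "eval_ac P ?r = 0" by (rule eval_ac_root_ac[OF P])
    have "(\<Sum>x\<in>?Z P. h x) = (\<Sum>i<n. h (?r ^ (CARD('a) ^ i)))"
      unfolding monic_prime_roots[OF P r]
      by (subst sum.reindex[OF inj_on_conjugates[OF monic_prime_root_primitive[OF P r]]]) simp
    thus ?thesis by (simp add: hpow[OF root_ac_in_fixed_field[OF P]])
  qed
  hence "int n * (\<Sum>P\<in>monic_primes n. h (root_ac P)) = (\<Sum>P\<in>monic_primes n. \<Sum>x\<in>?Z P. h x)"
    by (simp add: sum_distrib_left)
  also have "\<dots> = (\<Sum>x\<in>(\<Union>P\<in>monic_primes n. ?Z P). h x)"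
  proof (rule sum.UNION_disjoint[symmetric])
    show "\<forall>P\<in>monic_primes n. finite (?Z P)" by (intro ballI finite_eval_ac_roots) (erule monic_prime_neq_0)
    show "\<forall>P\<in>monic_primes n. \<forall>R\<in>monic_primes n. P \<noteq> R \<longrightarrow> ?Z P \<inter> ?Z R = {}"
    proof (intro ballI impI)
      fix P R :: "'a poly" assume PR: "P \<in> monic_primes n" "R \<in> monic_primes n" "P \<noteq> R"
      show "?Z P \<inter> ?Z R = {}"
      proof (rule ccontr)
        assume "?Z P \<inter> ?Z R \<noteq> {}"
        then obtain x where "eval_ac P x = 0" "eval_ac R x = 0" by blast
        hence "P dvd R" using monic_prime_dvd_iff[OF PR(1)] by blast
        with PR monic_irreducible_eq_of_dvd[of P R] show False by (auto simp: monic_primes_def)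
      qed
    qed
  qed simp
  also have "(\<Union>P\<in>monic_primes n. ?Z P) = primitive_elements n"
    using monic_prime_root_primitive exists_monic_prime_of_primitive[OF _ n] by blast
  finally show ?thesis .
qed

section \<open>Elements of proper subfields\<close>

lemma fixed_field_multiple:
  fixes x :: "'a::{finite,field} alg_closure"
  assumes "x \<in> fixed_field d"
  shows "x \<in> fixed_field (d * k)"
proof (induction k)
  case (Suc k)
  have "x ^ (CARD('a) ^ (d * Suc k)) = (x ^ (CARD('a) ^ d)) ^ (CARD('a) ^ (d * k))"
    by (simp add: power_add flip: power_mult)
  thus ?case using Suc assms by (simp add: fixed_field_def)
qed (simp add: fixed_field_def)

lemma primitive_period_dvd:
  fixes x :: "'a::{finite,field} alg_closure"
  assumes "x \<in> primitive_elements d" "d > 0" "x \<in> fixed_field n"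
  shows "d dvd n"
proof (rule ccontr)
  assume "\<not> d dvd n"
  hence r: "0 < n mod d" "n mod d < d" using assms(2) by (auto simp: dvd_eq_mod_eq_0)
  have "x \<in> fixed_field d" using assms(1) by (simp add: primitive_elements_def)
  hence "x \<in> fixed_field (d * (n div d))" by (rule fixed_field_multiple)
  hence 1: "x ^ (CARD('a) ^ (d * (n div d))) = x" by (simp add: fixed_field_def)
  have "CARD('a) ^ n = CARD('a) ^ (d * (n div d)) * CARD('a) ^ (n mod d)"
    by (simp flip: power_add)
  hence "x ^ (CARD('a) ^ n) = (x ^ (CARD('a) ^ (d * (n div d)))) ^ (CARD('a) ^ (n mod d))"
    by (simp add: power_mult)
  hence "x ^ (CARD('a) ^ (n mod d)) = x" using 1 assms(3) by (simp add: fixed_field_def)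
  hence "x \<in> fixed_field (n mod d)" by (simp add: fixed_field_def)
  thus False using r assms(1) by (auto simp: primitive_elements_def)
qed

lemma sum_powers_le: "2 \<le> (q::nat) \<Longrightarrow> (\<Sum>d=1..n. q ^ d) \<le> 2 * q ^ n"
proof (induction n)
  case (Suc n)
  hence "(\<Sum>d=1..Suc n. q ^ d) \<le> 2 * q ^ n + q ^ Suc n" by simp
  also have "2 * q ^ n \<le> q ^ Suc n" using Suc.prems by simp
  finally show ?case by simp
qed simp

text \<open>The degree of a non-primitive element is a proper divisor of \<open>n\<close>, so at
  most \<open>n div 2\<close>, and the sizes of these fields form a geometric sum.\<close>

lemma card_fixed_field_minus_primitive_le:
  assumes "n > 0"
  shows "card (fixed_field n - primitive_elements n :: 'a::{finite,field} alg_closure set)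
         \<le> 2 * CARD('a) ^ (n div 2)"
proof -
  have "(fixed_field n - primitive_elements n :: 'a alg_closure set)
      \<subseteq> (\<Union>d\<in>{1..n div 2}. fixed_field d)"
  proof
    fix x :: "'a alg_closure" assume x: "x \<in> fixed_field n - primitive_elements n"
    then obtain d where d: "d > 0" "x \<in> primitive_elements d"
      using assms by (blast elim: primitive_elements_period)
    have "d dvd n" using primitive_period_dvd[OF d(2,1)] x by blast
    then obtain k where k: "n = d * k" by (elim dvdE)
    have "k \<noteq> 0" "k \<noteq> 1" using k assms x d by auto
    hence "d * 2 \<le> n" unfolding k by (intro mult_left_mono) auto
    thus "x \<in> (\<Union>d\<in>{1..n div 2}. fixed_field d)"
      using d by (auto simp: primitive_elements_def intro!: bexI[of _ d])
  qed
  hence "card (fixed_field n - primitive_elements n :: 'a alg_closure set)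
      \<le> card (\<Union>d\<in>{1..n div 2}. fixed_field d :: 'a alg_closure set)"
    by (intro card_mono) (auto intro: finite_fixed_field)
  also have "\<dots> \<le> (\<Sum>d=1..n div 2. card (fixed_field d :: 'a alg_closure set))"
    by (rule card_UN_le) simp
  also have "\<dots> = (\<Sum>d=1..n div 2. CARD('a) ^ d)"
    by (intro sum.cong) (auto simp: card_fixed_field)
  also have "\<dots> \<le> 2 * CARD('a) ^ (n div 2)"
    by (rule sum_powers_le) (use card_field_gt_1[where 'a='a] in simp)
  finally show ?thesis .
qed

text \<open>Applied to character values and, with \<open>h = 1\<close>, to the counting of
  primes.\<close>

lemma abs_sum_monic_primes_diff_le:
  fixes h :: "'a::{finite,field} alg_closure \<Rightarrow> int"
  assumes n: "n > 0" and h: "\<And>x. x \<in> fixed_field n \<Longrightarrow> h (x ^ CARD('a)) = h x"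
    and h1: "\<And>x. \<bar>h x\<bar> \<le> 1"
  shows "\<bar>int n * (\<Sum>P\<in>monic_primes n. h (root_ac P)) - (\<Sum>x\<in>fixed_field n. h x)\<bar>
         \<le> 2 * CARD('a) ^ (n div 2)"
proof -
  let ?F = "fixed_field n :: 'a alg_closure set" and ?S = "primitive_elements n :: 'a alg_closure set"
  have "?S \<subseteq> ?F" by (auto simp: primitive_elements_def)
  hence "(\<Sum>x\<in>?F. h x) = (\<Sum>x\<in>?F - ?S. h x) + (\<Sum>x\<in>?S. h x)"
    by (rule sum.subset_diff[OF _ finite_fixed_field[OF n]])
  hence "\<bar>int n * (\<Sum>P\<in>monic_primes n. h (root_ac P)) - (\<Sum>x\<in>?F. h x)\<bar> = \<bar>\<Sum>x\<in>?F - ?S. h x\<bar>"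
    by (simp add: sum_monic_primes_eq_sum_primitive[of n h, OF n h])
  also have "\<dots> \<le> (\<Sum>x\<in>?F - ?S. \<bar>h x\<bar>)" by (rule sum_abs)
  also have "\<dots> \<le> (\<Sum>x\<in>?F - ?S. 1)" by (rule sum_mono) (rule h1)
  also have "\<dots> = int (card (?F - ?S))" by simp
  also have "\<dots> \<le> int (2 * CARD('a) ^ (n div 2))"
    using card_fixed_field_minus_primitive_le[OF n, where 'a='a] by (rule of_nat_mono)
  finally show ?thesis by simp
qed

section \<open>Reciprocity\<close>

text \<open>Evaluation at a root identifies the residues modulo \<open>P\<close>, represented by
  their remainders, with the field of \<open>q ^ n\<close> elements. Injectivity and equal
  cardinality suffice.\<close>

lemma bij_betw_eval_ac_polys_lt:
  fixes P :: "'a::{finite,field} poly"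
  assumes P: "P \<in> monic_primes n" and x: "eval_ac P x = 0"
  shows "bij_betw (\<lambda>p. eval_ac p x) (polys_lt n) (fixed_field n)"
proof -
  have n: "n > 0" by (rule monic_primes_pos[OF P])
  have prim: "x \<in> primitive_elements n" by (rule monic_prime_root_primitive[OF P x])
  have inj: "inj_on (\<lambda>p. eval_ac p x) (polys_lt n :: 'a poly set)"
  proof (rule inj_onI)
    fix p r :: "'a poly" assume pr: "p \<in> polys_lt n" "r \<in> polys_lt n" "eval_ac p x = eval_ac r x"
    hence "p - r \<in> polys_lt n" by (intro diff_in_polys_lt)
    hence "degree (p - r) < n" using polys_lt_iff_degree[OF n] by blast
    moreover have "eval_ac (p - r) x = 0" using pr by simp
    ultimately show "p = r"
      using degree_ge_of_eval_ac_eq_0[OF prim, of "p - r"] by auto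
  qed
  moreover have "(\<lambda>p. eval_ac p x) ` (polys_lt n :: 'a poly set) = fixed_field n"
  proof (rule card_subset_eq)
    show "finite (fixed_field n :: 'a alg_closure set)" by (rule finite_fixed_field[OF n])
    show "(\<lambda>p. eval_ac p x) ` (polys_lt n :: 'a poly set) \<subseteq> fixed_field n"
      using prim by (auto simp: primitive_elements_def intro: fixed_field_eval_ac)
    show "card ((\<lambda>p. eval_ac p x) ` (polys_lt n :: 'a poly set)) = card (fixed_field n :: 'a alg_closure set)"
      by (simp add: card_image[OF inj] card_polys_lt card_fixed_field[OF n])
  qed
  ultimately show ?thesis by (simp add: bij_betw_def)
qed

text \<open>Congruence modulo \<open>Q\<close> is equality of values at \<open>x\<close>, and
  evaluation is onto the field, so quadratic residues correspond to squares in the field.\<close>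

lemma poly_legendre_eq_quad_char:
  fixes Q :: "'a::{finite,field} poly"
  assumes odd: "odd CARD('a)" and Q: "Q \<in> monic_primes n" and x: "eval_ac Q x = 0"
  shows "poly_legendre D Q = quad_char n (eval_ac D x)"
proof (cases "Q dvd D")
  case True
  thus ?thesis using monic_prime_dvd_iff[OF Q x, of D] by (simp add: poly_legendre_def quad_char_def)
next
  case False
  have n: "n > 0" by (rule monic_primes_pos[OF Q])
  have nz: "eval_ac D x \<noteq> 0" using False monic_prime_dvd_iff[OF Q x, of D] by simp
  have "x \<in> fixed_field n"
    using monic_prime_root_primitive[OF Q x] by (simp add: primitive_elements_def)
  hence xfix: "eval_ac p x \<in> fixed_field n" for p by (rule fixed_field_eval_ac)
  have "(\<exists>Y. [Y ^ 2 = D] (mod Q)) \<longleftrightarrow> (\<exists>Y. (eval_ac Y x)\<^sup>2 = eval_ac D x)"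
    unfolding cong_iff_dvd_diff monic_prime_dvd_iff[OF Q x] by simp
  also have "\<dots> \<longleftrightarrow> (\<exists>y\<in>fixed_field n. y\<^sup>2 = eval_ac D x)"
    using xfix bij_betw_imp_surj_on[OF bij_betw_eval_ac_polys_lt[OF Q x]] by (metis imageE)
  also have "\<dots> \<longleftrightarrow> quad_char n (eval_ac D x) = 1"
    by (rule quad_char_eq_1_iff[OF odd n xfix nz, symmetric])
  finally show ?thesis using False nz by (auto simp: poly_legendre_def quad_char_def)
qed

text \<open>As \<open>(q ^ n - 1) / 2\<close> is \<open>1 + q + ... + q ^ (n - 1)\<close> times
  \<open>(q - 1) / 2\<close>, the quadratic character of the large field is that of F_q composed
  with the norm.\<close>

lemma power_half_eq_power_norm:
  fixes x :: "'a::{finite,field} alg_closure"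
  assumes odd: "odd CARD('a)"
  shows "x ^ ((CARD('a) ^ n - 1) div 2) = (\<Prod>i<n. x ^ (CARD('a) ^ i)) ^ ((CARD('a) - 1) div 2)"
proof -
  let ?q = "CARD('a)"
  obtain r where r: "?q = 2 * r + 1" using odd by (rule oddE)
  have "(2 * r) * (\<Sum>i<n. ?q ^ i) + 1 = ?q ^ n"
    by (induction n) (auto simp: r algebra_simps)
  hence "?q ^ n - 1 = 2 * ((\<Sum>i<n. ?q ^ i) * r)"
    by (simp add: algebra_simps)
  hence "(?q ^ n - 1) div 2 = (\<Sum>i<n. ?q ^ i) * r" by simp
  moreover have "(?q - 1) div 2 = r" using r by simp
  ultimately show ?thesis by (simp add: power_sum power_mult)
qed

text \<open>The quadratic character of F_q at the constant left over when the two arguments of the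
  symbol are exchanged. It depends on \<open>P\<close> only through its degree
  \<open>n\<close>.\<close>

definition twist_sign :: "'a::{finite,field} \<Rightarrow> nat \<Rightarrow> int" where
  "twist_sign c n = quad_char 1 (to_ac (c * (-1) ^ n))"

lemma twist_sign_cases: "c \<noteq> 0 \<Longrightarrow> twist_sign c n \<in> {1, -1}"
  by (auto simp: twist_sign_def quad_char_def)

text \<open>Both sides are powers of the resultant of \<open>P\<close> and \<open>Q\<close>, up to order of the factors.\<close>
lemma legendre_reciprocity:
  fixes P Q :: "'a::{finite,field} poly"
  assumes odd: "odd CARD('a)"
    and P: "P \<in> monic_primes n" and \<alpha>: "eval_ac P \<alpha> = 0" and Q: "Q \<in> monic_primes d"
  shows "poly_legendre (smult c P) Q = twist_sign c n ^ d * quad_char n (eval_ac Q \<alpha>)"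
proof -
  let ?q = "CARD('a)"
  define h where "h = (?q - 1) div 2"
  define \<beta> where "\<beta> = root_ac Q"
  have \<beta>: "eval_ac Q \<beta> = 0" unfolding \<beta>_def by (rule eval_ac_root_ac[OF Q])
  have n: "n > 0" and d: "d > 0" by (rule monic_primes_pos[OF P], rule monic_primes_pos[OF Q])
  have \<alpha>fix: "eval_ac p \<alpha> \<in> fixed_field n" for p
    using monic_prime_root_primitive[OF P \<alpha>] by (auto simp: primitive_elements_def intro: fixed_field_eval_ac)
  have \<beta>fix: "eval_ac p \<beta> \<in> fixed_field d" for p
    using monic_prime_root_primitive[OF Q \<beta>] by (auto simp: primitive_elements_def intro: fixed_field_eval_ac)
  let ?x = "eval_ac (smult c P) \<beta>" and ?y = "eval_ac Q \<alpha>" and ?u = "to_ac (c * (-1) ^ n)"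
  have swap: "?x ^ (?q ^ i) = ?u * (\<Prod>j<n. \<alpha> ^ (?q ^ j) - \<beta> ^ (?q ^ i))" for i
  proof -
    have "?x ^ (?q ^ i) = eval_ac (smult c P) (\<beta> ^ (?q ^ i))" by (rule eval_ac_frobenius_pow)
    \<comment> \<open>Reversing the \<open>n\<close> differences is the source of
      \<open>(-1) ^ n\<close>.\<close>
    also have "\<dots> = to_ac c * (\<Prod>j<n. (-1) * (\<alpha> ^ (?q ^ j) - \<beta> ^ (?q ^ i)))"
      unfolding eval_ac_smult eval_ac_monic_prime_eq_prod[OF P \<alpha>] by simp
    also have "\<dots> = ?u * (\<Prod>j<n. \<alpha> ^ (?q ^ j) - \<beta> ^ (?q ^ i))"
      unfolding prod.distrib by simp
    finally show ?thesis .
  qed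
  have "(\<Prod>i<d. ?x ^ (?q ^ i)) = ?u ^ d * (\<Prod>i<d. \<Prod>j<n. \<alpha> ^ (?q ^ j) - \<beta> ^ (?q ^ i))"
    unfolding swap prod.distrib by simp
  \<comment> \<open>The conjugates of \<open>\<beta>\<close> are all the roots of \<open>Q\<close>,
    so exchanging the products gives the norm of the value of \<open>Q\<close> at
    \<open>\<alpha>\<close>.\<close>
  also have "(\<Prod>i<d. \<Prod>j<n. \<alpha> ^ (?q ^ j) - \<beta> ^ (?q ^ i)) = (\<Prod>j<n. ?y ^ (?q ^ j))"
    unfolding eval_ac_frobenius_pow[of Q] unfolding eval_ac_monic_prime_eq_prod[OF Q \<beta>]
    by (rule prod.swap)
  finally have "(\<Prod>i<d. ?x ^ (?q ^ i)) ^ h = (?u ^ h) ^ d * (\<Prod>j<n. ?y ^ (?q ^ j)) ^ h"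
    by (simp only: power_mult_distrib mult.commute flip: power_mult)
  moreover have "?u ^ h = of_int (twist_sign c n)"
    using of_int_quad_char[OF odd zero_less_one fixed_field_to_ac, of "c * (-1) ^ n"]
    unfolding twist_sign_def h_def by simp
  moreover have "?y ^ ((?q ^ n - 1) div 2) = of_int (quad_char n ?y)"
    by (rule of_int_quad_char[OF odd n \<alpha>fix, symmetric])
  ultimately have eq: "?x ^ ((?q ^ d - 1) div 2) = of_int (twist_sign c n ^ d * quad_char n ?y)"
    unfolding power_half_eq_power_norm[OF odd] h_def by simp
  have "poly_legendre (smult c P) Q = quad_char d ?x"
    by (rule poly_legendre_eq_quad_char[OF odd Q \<beta>])
  also have "\<dots> = twist_sign c n ^ d * quad_char n ?y"
  proof (rule quad_char_eqI[OF odd d \<beta>fix _ eq])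
    have "twist_sign c n \<in> {-1, 0, 1}" by (auto simp: twist_sign_def quad_char_def)
    hence "twist_sign c n ^ d \<in> {-1, 0, 1}"
      using d by (cases "even d") (auto simp: power_0_left)
    thus "twist_sign c n ^ d * quad_char n ?y \<in> {-1, 0, 1}"
      by (auto simp: quad_char_def)
  qed
  finally show ?thesis .
qed

section \<open>Multiplicativity of the Jacobi symbol\<close>

lemma Max_power_dvd_eqI:
  fixes P f :: "'b::comm_semiring_1"
  assumes "P ^ n dvd f" "\<not> P ^ Suc n dvd f"
  shows "Max {k. P ^ k dvd f} = n"
proof -
  have "k \<le> n" if "P ^ k dvd f" for k
    using that assms(2) by (meson dvd_trans le_imp_power_dvd not_less_eq_eq)
  thus ?thesis using assms(1) by (intro Max_eqI) (auto intro: finite_subset[of _ "{..n}"])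
qed

lemma power_dvd_maximal:
  fixes P f :: "'b::field poly"
  assumes "f \<noteq> 0" "degree P > 0"
  obtains n u where "f = P ^ n * u" "\<not> P dvd u"
proof -
  have bound: "k \<le> degree f" if "P ^ k dvd f" for k
  proof -
    have "k * 1 \<le> k * degree P" using assms(2) by (intro mult_left_mono) auto
    also have "\<dots> = degree (P ^ k)" using assms(2) by (subst degree_power_eq) auto
    also have "\<dots> \<le> degree f" by (rule dvd_imp_degree_le[OF that assms(1)])
    finally show ?thesis by simp
  qed
  define n where "n = (GREATEST k. P ^ k dvd f)"
  have "P ^ n dvd f" unfolding n_def
    by (rule GreatestI_nat[of "\<lambda>k. P ^ k dvd f" 0 "degree f"]) (auto intro: bound)
  then obtain u where u: "f = P ^ n * u" by (elim dvdE)
  have "\<not> P dvd u"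
  proof
    assume "P dvd u"
    hence "P ^ Suc n dvd f" unfolding u power_Suc2 by (rule mult_dvd_mono[OF dvd_refl])
    hence "Suc n \<le> n" unfolding n_def
      by (intro Greatest_le_nat[of "\<lambda>k. P ^ k dvd f" _ "degree f"]) (auto intro: bound)
    thus False by simp
  qed
  with u that show ?thesis by blast
qed

text \<open>Multiplicities are additive because \<open>P\<close> is prime, and a \<open>Q\<close>
  different from \<open>P\<close> is not divisible by it.\<close>

lemma Max_power_dvd_mult:
  fixes P Q h :: "'b::field poly"
  assumes "irreducible P" "irreducible Q" "lead_coeff P = 1" "lead_coeff Q = 1" "h \<noteq> 0"
  shows "Max {k. P ^ k dvd Q * h} = Max {k. P ^ k dvd h} + (if P = Q then 1 else 0)"
proof -
  have P: "P \<noteq> 0" "degree P > 0"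
    using assms(1) by (auto simp: irreducible_def is_unit_iff_degree)
  have prime: "prime_elem P" by (rule field_poly_irreducible_imp_prime[OF assms(1)])
  obtain n u where u: "h = P ^ n * u" "\<not> P dvd u"
    by (rule power_dvd_maximal[OF assms(5) P(2)])
  have ndvd: "\<not> P ^ Suc k dvd P ^ k * v" if "\<not> P dvd v" for k v
    using that P by (simp add: power_Suc2 del: power_Suc)
  have h: "Max {k. P ^ k dvd h} = n"
    by (rule Max_power_dvd_eqI) (use u ndvd in auto)
  show ?thesis
  proof (cases "P = Q")
    case True
    have "Q * h = P ^ Suc n * u" using True u by (simp add: ac_simps)
    hence "Max {k. P ^ k dvd Q * h} = Suc n"
      using ndvd[OF u(2), of "Suc n"] by (intro Max_power_dvd_eqI) auto
    thus ?thesis using h True by simp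
  next
    case False
    hence "\<not> P dvd Q" using monic_irreducible_eq_of_dvd assms by blast
    hence "\<not> P dvd Q * u" using u(2) prime_elem_dvd_mult_iff[OF prime] by blast
    moreover have "Q * h = P ^ n * (Q * u)" using u by (simp add: ac_simps)
    ultimately have "Max {k. P ^ k dvd Q * h} = n"
      using ndvd[of "Q * u" n] by (intro Max_power_dvd_eqI) auto
    thus ?thesis using h False by simp
  qed
qed

lemma finite_monic_irreducible_divisors:
  fixes f :: "'a::{finite,field} poly"
  assumes "f \<noteq> 0"
  shows "finite {P. lead_coeff P = 1 \<and> irreducible P \<and> P dvd f}"
proof (rule finite_subset)
  show "{P. lead_coeff P = 1 \<and> irreducible P \<and> P dvd f} \<subseteq> polys_lt (Suc (degree f))"
    using dvd_imp_degree_le[OF _ assms] by (auto simp: polys_lt_iff_degree less_Suc_eq_le)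
qed simp

lemma poly_jacobi_1 [simp]: "poly_jacobi D 1 = 1"
proof -
  have "{P :: 'a poly. lead_coeff P = 1 \<and> irreducible P \<and> P dvd 1} = {}"
    by (auto simp: irreducible_def)
  thus ?thesis by (simp only: poly_jacobi_def) simp
qed

text \<open>Peeling off one prime factor at a time is the form of multiplicativity that an induction
  on the degree calls for.\<close>

lemma poly_jacobi_mult_prime:
  fixes Q h :: "'a::{finite,field} poly"
  assumes Q: "irreducible Q" "lead_coeff Q = 1" and h: "h \<noteq> 0"
  shows "poly_jacobi D (Q * h) = poly_legendre D Q * poly_jacobi D h"
proof -
  define T where "T = (\<lambda>f :: 'a poly. {P. lead_coeff P = 1 \<and> irreducible P \<and> P dvd f})"
  have Qh: "Q * h \<noteq> 0" using Q h by auto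
  have fin: "finite (T (Q * h))" unfolding T_def by (rule finite_monic_irreducible_divisors[OF Qh])
  have "poly_jacobi D (Q * h) = (\<Prod>P\<in>T (Q * h). poly_legendre D P ^ Max {k. P ^ k dvd Q * h})"
    by (simp add: poly_jacobi_def T_def)
  also have "\<dots> = (\<Prod>P\<in>T (Q * h). poly_legendre D P ^ Max {k. P ^ k dvd h} *
      (if P = Q then poly_legendre D P else 1))"
    by (intro prod.cong refl) (subst Max_power_dvd_mult, use Q h in \<open>auto simp: T_def\<close>)
  also have "\<dots> = (\<Prod>P\<in>T (Q * h). poly_legendre D P ^ Max {k. P ^ k dvd h}) * poly_legendre D Q"
    using fin Q by (simp add: prod.distrib prod.delta T_def)
  also have "(\<Prod>P\<in>T (Q * h). poly_legendre D P ^ Max {k. P ^ k dvd h}) =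
      (\<Prod>P\<in>T h. poly_legendre D P ^ Max {k. P ^ k dvd h})"
  proof (rule prod.mono_neutral_right[OF fin])
    show "T h \<subseteq> T (Q * h)" by (auto simp: T_def)
    show "\<forall>P\<in>T (Q * h) - T h. poly_legendre D P ^ Max {k. P ^ k dvd h} = 1"
    proof
      fix P assume "P \<in> T (Q * h) - T h"
      hence "\<not> P dvd h" by (auto simp: T_def)
      hence "Max {k. P ^ k dvd h} = 0" by (intro Max_power_dvd_eqI) auto
      thus "poly_legendre D P ^ Max {k. P ^ k dvd h} = 1" by simp
    qed
  qed
  finally show ?thesis by (simp add: poly_jacobi_def T_def)
qed

lemma exists_monic_irreducible_dvd:
  fixes f :: "'b::field poly"
  assumes "degree f > 0"
  obtains Q h where "irreducible Q" "lead_coeff Q = 1" "f = Q * h"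
proof -
  obtain r where r: "irreducible r" "r dvd f" using exists_irreducible_dvd[OF assms] by blast
  have r0: "r \<noteq> 0" using r(1) by auto
  let ?Q = "smult (inverse (lead_coeff r)) r"
  have assoc: "?Q dvd x \<longleftrightarrow> r dvd x" for x using r0 by (simp add: smult_dvd_iff)
  have "degree r > 0" using r(1) r0 by (auto simp: irreducible_def is_unit_iff_degree)
  have "prime_elem ?Q"
    using field_poly_irreducible_imp_prime[OF r(1)] r0
    by (simp add: prime_elem_def is_unit_smult_iff assoc)
  hence "irreducible ?Q" by (rule prime_elem_imp_irreducible)
  moreover have "lead_coeff ?Q = 1" using r0 by simp
  moreover obtain h where "f = ?Q * h" using assoc[of f] r(2) by (auto elim: dvdE)
  ultimately show ?thesis by (rule that)
qed

text \<open>Both symbols are multiplicative in \<open>f\<close>, and the sign depends only on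
  degrees, so it accumulates to the power \<open>m\<close> as prime factors are removed.\<close>

lemma poly_jacobi_reciprocity:
  fixes P f :: "'a::{finite,field} poly"
  assumes odd: "odd CARD('a)" and P: "P \<in> monic_primes n" and \<alpha>: "eval_ac P \<alpha> = 0"
    and "f \<in> monics m"
  shows "poly_jacobi (smult c P) f = twist_sign c n ^ m * quad_char n (eval_ac f \<alpha>)"
  using \<open>f \<in> monics m\<close>
proof (induction m arbitrary: f rule: less_induct)
  case (less m)
  have n: "n > 0" by (rule monic_primes_pos[OF P])
  have \<alpha>fix: "eval_ac p \<alpha> \<in> fixed_field n" for p
    using monic_prime_root_primitive[OF P \<alpha>] by (auto simp: primitive_elements_def intro: fixed_field_eval_ac)
  show ?case
  proof (cases "m = 0")
    case True
    hence "f = 1" using less.prems by (auto simp: monics_def one_pCons elim!: degree_eq_zeroE)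
    thus ?thesis using True by (simp add: quad_char_1[OF odd n])
  next
    case False
    hence "degree f > 0" using less.prems by (simp add: monics_def)
    then obtain Q h where Q: "irreducible Q" "lead_coeff Q = 1" and f: "f = Q * h"
      by (rule exists_monic_irreducible_dvd)
    have "lead_coeff f = 1" "degree f = m" using less.prems by (auto simp: monics_def)
    hence "f \<noteq> 0" by auto
    hence "Q \<noteq> 0" "h \<noteq> 0" using f by auto
    hence h: "degree Q + degree h = m" "h \<noteq> 0"
      using f \<open>degree f = m\<close> by (simp_all add: degree_mult_eq)
    have lch: "lead_coeff h = 1"
      using \<open>lead_coeff f = 1\<close> Q(2) unfolding f lead_coeff_mult by simp
    have Qp: "Q \<in> monic_primes (degree Q)" using Q by (simp add: monic_primes_def)
    have "h \<in> monics (degree h)" using lch by (simp add: monics_def)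
    hence "poly_jacobi (smult c P) h = twist_sign c n ^ degree h * quad_char n (eval_ac h \<alpha>)"
      using less.IH[of "degree h" h] h(1) monic_primes_pos[OF Qp] by simp
    thus ?thesis
      unfolding f poly_jacobi_mult_prime[OF Q h(2)] legendre_reciprocity[OF odd P \<alpha> Qp]
      using h(1) by (simp add: quad_char_mult[OF odd n \<alpha>fix \<alpha>fix] ac_simps flip: power_add)
  qed
qed

lemma add_in_monics: "f \<in> monics m \<Longrightarrow> h \<in> polys_lt n \<Longrightarrow> n \<le> m \<Longrightarrow> f + h \<in> monics m"
proof -
  assume f: "f \<in> monics m" and h: "h \<in> polys_lt n" and nm: "n \<le> m"
  have "coeff (f + h) m = 1" using f h nm by (auto simp: monics_def polys_lt_def)
  moreover have "coeff (f + h) k = 0" if "k > m" for k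
    using f h nm that by (auto simp: monics_def polys_lt_def coeff_eq_0)
  hence "degree (f + h) \<le> m" by (intro degree_le) auto
  ultimately have "degree (f + h) = m" using le_degree[of "f + h" m] by auto
  with \<open>coeff (f + h) m = 1\<close> show ?thesis by (simp add: monics_def)
qed

text \<open>For \<open>m \<ge> n\<close> the residues modulo \<open>P\<close> are equidistributed on the monic polynomials of degree \<open>m\<close>.\<close>
lemma sum_monics_quad_char_eq_0:
  fixes P :: "'a::{finite,field} poly"
  assumes odd: "odd CARD('a)" and P: "P \<in> monic_primes n" and \<alpha>: "eval_ac P \<alpha> = 0" and "n \<le> m"
  shows "(\<Sum>f\<in>monics m. quad_char n (eval_ac f \<alpha>)) = 0"
proof -
  let ?S = "\<Sum>f\<in>monics m. quad_char n (eval_ac f \<alpha>)" and ?F = "fixed_field n :: 'a alg_closure set"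
  have n: "n > 0" by (rule monic_primes_pos[OF P])
  have \<alpha>fix: "eval_ac p \<alpha> \<in> ?F" for p
    using monic_prime_root_primitive[OF P \<alpha>] by (auto simp: primitive_elements_def intro: fixed_field_eval_ac)
  \<comment> \<open>Since \<open>n \<le> m\<close>, adding \<open>h\<close> keeps \<open>f\<close>
    monic of degree \<open>m\<close>. Summing over all \<open>h\<close> then makes the values at
    \<open>\<alpha>\<close> run over the whole field, where the character sums to 0.\<close>
  have "?S = (\<Sum>f\<in>monics m. quad_char n (eval_ac (f + h) \<alpha>))" if h: "h \<in> polys_lt n" for h
  proof (rule sum.reindex_bij_betw[symmetric], rule bij_betwI[where g = "\<lambda>f. f - h"])
    have "- h \<in> polys_lt n" using h by (simp add: polys_lt_def)
    thus "(\<lambda>f. f - h) \<in> monics m \<rightarrow> monics m"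
      using add_in_monics[OF _ _ \<open>n \<le> m\<close>, of _ "-h"] by auto
    show "(\<lambda>f. f + h) \<in> monics m \<rightarrow> monics m" using add_in_monics[OF _ h \<open>n \<le> m\<close>] by auto
  qed auto
  hence "(\<Sum>h\<in>(polys_lt n :: 'a poly set). ?S) =
      (\<Sum>h\<in>polys_lt n. \<Sum>f\<in>monics m. quad_char n (eval_ac (f + h) \<alpha>))"
    by (rule sum.cong[OF refl])
  also have "\<dots> = (\<Sum>f\<in>monics m. \<Sum>h\<in>polys_lt n. quad_char n (eval_ac f \<alpha> + eval_ac h \<alpha>))"
    by (subst sum.swap) simp
  also have "\<dots> = (\<Sum>f\<in>(monics m :: 'a poly set). 0)"
  proof (rule sum.cong[OF refl])
    fix f :: "'a poly"
    have "(\<Sum>h\<in>polys_lt n. quad_char n (eval_ac f \<alpha> + eval_ac h \<alpha>))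
        = (\<Sum>y\<in>?F. quad_char n (eval_ac f \<alpha> + y))"
      by (rule sum.reindex_bij_betw[OF bij_betw_eval_ac_polys_lt[OF P \<alpha>]])
    also have "\<dots> = (\<Sum>y\<in>?F. quad_char n y)"
    proof (rule sum.reindex_bij_betw, rule bij_betwI[where g = "\<lambda>y. y - eval_ac f \<alpha>"])
      show "(\<lambda>y. y - eval_ac f \<alpha>) \<in> ?F \<rightarrow> ?F"
        using fixed_field_add[OF _ \<alpha>fix[of "-f"]] by auto
      show "(+) (eval_ac f \<alpha>) \<in> ?F \<rightarrow> ?F" using fixed_field_add[OF \<alpha>fix] by auto
    qed auto
    also have "\<dots> = 0" by (rule sum_quad_char[OF odd n])
    finally show "(\<Sum>h\<in>polys_lt n. quad_char n (eval_ac f \<alpha> + eval_ac h \<alpha>)) = 0" .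
  qed
  finally show ?thesis by (simp add: card_polys_lt)
qed

section \<open>The first moment\<close>

lemma card_monics: "card (monics n :: 'a::{finite,field} poly set) = CARD('a) ^ n"
proof -
  have "bij_betw (\<lambda>h. monom 1 n + h) (polys_lt n :: 'a poly set) (monics n)"
  proof (rule bij_betwI[where g = "\<lambda>f. f - monom 1 n"])
    have "monom (1 :: 'a) n \<in> monics n" by (simp add: monics_def degree_monom_eq)
    thus "(\<lambda>h. monom 1 n + h) \<in> polys_lt n \<rightarrow> (monics n :: 'a poly set)"
      using add_in_monics by blast
    have "coeff (f - monom 1 n) k = 0" if "f \<in> monics n" "n \<le> k" for f :: "'a poly" and k
      using that by (cases "k = n") (auto simp: monics_def coeff_eq_0)
    thus "(\<lambda>f. f - monom 1 n) \<in> monics n \<rightarrow> (polys_lt n :: 'a poly set)"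
      by (auto simp: polys_lt_def)
  qed auto
  from bij_betw_same_card[OF this] show ?thesis by (simp add: card_polys_lt)
qed

lemma monic_neq_minus_monic:
  fixes l :: "'a::{finite,field} poly"
  assumes "odd CARD('a)" "lead_coeff l = 1"
  shows "lead_coeff (- l) \<noteq> 1"
proof
  assume "lead_coeff (- l) = 1"
  hence "- 1 = (1 :: 'a)" using assms(2) by (metis coeff_minus degree_minus)
  hence "(1 :: 'a alg_closure) = -1" by (metis to_ac_1 to_ac_minus)
  thus False using one_neq_minus_one[OF assms(1)] by simp
qed

text \<open>Squaring is injective on monic polynomials because \<open>l\<close> and
  \<open>- l\<close> cannot both be monic when \<open>q\<close> is odd, and a square root of a monic
  polynomial is monic up to sign.\<close>

lemma card_monic_squares:
  assumes odd: "odd CARD('a::{finite,field})"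
  shows "card {f \<in> monics n :: 'a poly set. \<exists>l. f = l ^ 2} = (if even n then CARD('a) ^ (n div 2) else 0)"
proof -
  have deg: "degree (l ^ 2) = 2 * degree l" for l :: "'a poly"
    by (cases "l = 0") (simp_all add: degree_power_eq power_0_left)
  show ?thesis
  proof (cases "even n")
    case False
    hence "{f \<in> monics n :: 'a poly set. \<exists>l. f = l ^ 2} = {}"
      by (auto simp: monics_def deg)
    thus ?thesis using False by simp
  next
    case True
    have "{f \<in> monics n :: 'a poly set. \<exists>l. f = l ^ 2} = (\<lambda>l. l ^ 2) ` monics (n div 2)"
    proof (intro equalityI subsetI)
      fix f :: "'a poly" assume "f \<in> {f \<in> monics n. \<exists>l. f = l ^ 2}"
      then obtain l where l: "f = l ^ 2" "l ^ 2 \<in> monics n" by blast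
      have "lead_coeff (l ^ 2) = 1" using l(2) unfolding monics_def by blast
      hence "(lead_coeff l)\<^sup>2 = 1" by (simp only: lead_coeff_power)
      moreover have "degree l = n div 2" using l(2) by (auto simp: monics_def deg)
      ultimately have "l \<in> monics (n div 2) \<or> - l \<in> monics (n div 2)"
        by (auto simp: monics_def power2_eq_1_iff)
      moreover have "f = (- l) ^ 2" using l by simp
      ultimately show "f \<in> (\<lambda>l. l ^ 2) ` monics (n div 2)" using l(1) by blast
    next
      fix f :: "'a poly" assume "f \<in> (\<lambda>l. l ^ 2) ` monics (n div 2)"
      then obtain l where l: "f = l ^ 2" "l \<in> monics (n div 2)" by blast
      have lc: "lead_coeff l = 1" "degree l = n div 2" using l(2) by (auto simp: monics_def)
      have "lead_coeff f = 1" unfolding l(1) lead_coeff_power lc(1) by simp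
      moreover have "degree f = n" unfolding l(1) deg lc(2) using True by simp
      ultimately show "f \<in> {f \<in> monics n. \<exists>l. f = l ^ 2}" using l by (auto simp: monics_def)
    qed
    moreover have "inj_on (\<lambda>l. l ^ 2) (monics (n div 2) :: 'a poly set)"
    proof (rule inj_onI)
      fix l k :: "'a poly" assume lk: "l \<in> monics (n div 2)" "k \<in> monics (n div 2)" "l ^ 2 = k ^ 2"
      hence "l = k \<or> l = - k" by (simp add: power2_eq_iff)
      moreover have "l \<noteq> - k"
        using lk monic_neq_minus_monic[OF odd, of k] by (auto simp: monics_def)
      ultimately show "l = k" by blast
    qed
    ultimately show ?thesis using True by (simp add: card_image card_monics)
  qed
qed

section \<open>Character sums over the primes of degree \<open>n\<close>\<close>

definition prime_char_sum :: "nat \<Rightarrow> 'a::{finite,field} poly \<Rightarrow> int" where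
  "prime_char_sum n f = (\<Sum>P\<in>monic_primes n. quad_char n (eval_ac f (root_ac P)))"

text \<open>A nonzero \<open>l\<close> of degree below \<open>n\<close> does not vanish at a root of
  a prime of degree \<open>n\<close>, so every term is 1. This is the diagonal contribution.\<close>

lemma prime_char_sum_square:
  fixes l :: "'a::{finite,field} poly"
  assumes odd: "odd CARD('a)" and l: "l \<noteq> 0" "degree l < n"
  shows "prime_char_sum n (l ^ 2) = card (monic_primes n :: 'a poly set)"
proof -
  have "quad_char n (eval_ac (l ^ 2) (root_ac P)) = 1" if P: "P \<in> monic_primes n" for P
  proof -
    let ?y = "eval_ac l (root_ac P)"
    have n: "n > 0" by (rule monic_primes_pos[OF P])
    have y: "?y \<in> fixed_field n" by (rule fixed_field_eval_ac[OF root_ac_in_fixed_field[OF P]])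
    have "?y \<noteq> 0"
      using degree_ge_of_eval_ac_eq_0[OF monic_prime_root_primitive[OF P eval_ac_root_ac[OF P]] _ l(1)] l(2)
      by auto
    thus ?thesis
      using quad_char_eq_1_iff[OF odd n, of "?y\<^sup>2"] y fixed_field_mult[OF y y]
      by (auto simp: power2_eq_square)
  qed
  thus ?thesis by (simp add: prime_char_sum_def)
qed

text \<open>An odd power does not change a sign. This is the invariance required for passing from
  primes to roots.\<close>

lemma quad_char_frobenius:
  fixes y :: "'a::{finite,field} alg_closure"
  assumes odd: "odd CARD('a)" and n: "n > 0" and y: "y \<in> fixed_field n"
  shows "quad_char n (y ^ CARD('a)) = quad_char n y"
proof (rule quad_char_eqI[OF odd n _ quad_char_cases[OF odd n]])
  show "y ^ CARD('a) \<in> fixed_field n" using fixed_field_frobenius_pow[OF y, of 1] by simp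
  have "(y ^ CARD('a)) ^ ((CARD('a) ^ n - 1) div 2) = (y ^ ((CARD('a) ^ n - 1) div 2)) ^ CARD('a)"
    by (simp add: mult.commute flip: power_mult)
  also have "\<dots> = of_int (quad_char n y) ^ CARD('a)"
    by (simp add: of_int_quad_char[OF odd n y])
  also have "\<dots> = of_int (quad_char n y)"
    using odd quad_char_cases[OF odd n, of y] by (auto simp: power_0_left)
  finally show "(y ^ CARD('a)) ^ ((CARD('a) ^ n - 1) div 2) = of_int (quad_char n y)" .
qed

text \<open>The complete sum costs a factor \<open>n\<close> through the degree of \<open>f\<close>,
  which is regained because each prime has \<open>n\<close> roots. The 8 is 6 from the complete sum
  plus 2 from proper subfields.\<close>

lemma abs_prime_char_sum_le:
  fixes f :: "'a::{finite,field} poly" and n :: nat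
  defines "E \<equiv> CARD('a) ^ (n - n div 2)"
  assumes odd: "odd CARD('a)" and f: "lead_coeff f = 1" "degree f < n" "\<nexists>l. f = l ^ 2"
    and E: "5 \<le> E" "4 * n \<le> E"
  shows "\<bar>prime_char_sum n f\<bar> \<le> 8 * int E"
proof -
  let ?d = "n div 2" and ?e = "n - n div 2"
  have n: "n > 0" using f(2) by simp
  let ?S = "\<Sum>x\<in>fixed_field n. quad_char n (eval_ac f x)"
  \<comment> \<open>Splitting \<open>n\<close> into its rounded-down and rounded-up halves makes
    \<open>M\<close> and \<open>E\<close> as nearly equal as possible.\<close>
  have "\<bar>\<Sum>x\<in>fixed_field (?d + ?e). quad_char (?d + ?e) (eval_ac f x)\<bar>
      \<le> int (6 * (degree f + 1) * CARD('a) ^ ?e)"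
    by (rule abs_sum_quad_char_eval_le[OF odd f(1,3)]) (use E f(2) in \<open>auto simp: E_def\<close>)
  moreover have "?d + ?e = n" by simp
  ultimately have "\<bar>?S\<bar> \<le> int (6 * (degree f + 1) * E)" unfolding E_def by metis
  also have "\<dots> \<le> int (6 * n * E)" by (intro of_nat_mono mult_right_mono mult_left_mono) (use f(2) in auto)
  finally have 1: "\<bar>?S\<bar> \<le> int (6 * n * E)" .
  have "\<bar>int n * (\<Sum>P\<in>monic_primes n. quad_char n (eval_ac f (root_ac P))) - ?S\<bar>
      \<le> 2 * CARD('a) ^ (n div 2)"
  proof (rule abs_sum_monic_primes_diff_le[OF n])
    show "\<bar>quad_char n (eval_ac f x)\<bar> \<le> 1" for x :: "'a alg_closure" by (simp add: quad_char_def)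
    fix x :: "'a alg_closure" assume "x \<in> fixed_field n"
    hence "quad_char n (eval_ac f x ^ CARD('a)) = quad_char n (eval_ac f x)"
      by (intro quad_char_frobenius odd n fixed_field_eval_ac)
    thus "quad_char n (eval_ac f (x ^ CARD('a))) = quad_char n (eval_ac f x)"
      using eval_ac_frobenius_pow[of f x 1] by simp
  qed
  also have "int (2 * CARD('a) ^ (n div 2)) \<le> int (2 * n * E)"
  proof (rule of_nat_mono)
    have "CARD('a) ^ (n div 2) \<le> E" unfolding E_def by (rule power_increasing) auto
    also have "\<dots> \<le> n * E" using n by simp
    finally show "2 * CARD('a) ^ (n div 2) \<le> 2 * n * E" by simp
  qed
  finally have "\<bar>int n * prime_char_sum n f - ?S\<bar> \<le> int (2 * n * E)"
    unfolding prime_char_sum_def by simp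
  with 1 have "\<bar>int n * prime_char_sum n f\<bar> \<le> int (6 * n * E) + int (2 * n * E)" by linarith
  also have "\<dots> = int n * (8 * int E)" by (simp add: algebra_simps)
  finally have "int n * \<bar>prime_char_sum n f\<bar> \<le> int n * (8 * int E)" by (simp add: abs_mult)
  thus ?thesis using n by simp
qed

text \<open>The prime polynomial theorem with an explicit error, from the constant function
  1.\<close>

lemma abs_card_monic_primes_diff_le:
  assumes n: "n > 0"
  shows "\<bar>real n * real (card (monic_primes n :: 'a::{finite,field} poly set)) - real CARD('a) ^ n\<bar>
         \<le> 2 * real CARD('a) ^ (n div 2)"
proof -
  have "\<bar>int n * (\<Sum>P\<in>(monic_primes n :: 'a poly set). 1) - (\<Sum>x\<in>(fixed_field n :: 'a alg_closure set). 1)\<bar>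
      \<le> 2 * CARD('a) ^ (n div 2)"
    using abs_sum_monic_primes_diff_le[OF n, of "\<lambda>_ :: 'a alg_closure. 1"] by simp
  hence "\<bar>int n * int (card (monic_primes n :: 'a poly set)) - int CARD('a) ^ n\<bar> \<le> 2 * int CARD('a) ^ (n div 2)"
    by (simp add: card_fixed_field[OF n])
  hence "real_of_int \<bar>int n * int (card (monic_primes n :: 'a poly set)) - int CARD('a) ^ n\<bar>
      \<le> real_of_int (2 * int CARD('a) ^ (n div 2))" by (simp only: of_int_le_iff)
  thus ?thesis by simp
qed

text \<open>Reciprocity rewrites the terms of each degree, and equidistribution kills the degrees
  \<open>m \<ge> n\<close>, so the series is a finite sum.\<close>

lemma L_poly_1_eq:
  fixes P :: "'a::{finite,field} poly"
  assumes odd: "odd CARD('a)" and P: "P \<in> monic_primes n"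
  shows "L_poly 1 (smult c P) = of_real (\<Sum>m<n. real_of_int (twist_sign c n ^ m) *
    (\<Sum>f\<in>monics m. real_of_int (quad_char n (eval_ac f (root_ac P)))) / real CARD('a) ^ m)"
proof -
  let ?t = "\<lambda>m. real_of_int (twist_sign c n ^ m) *
      (\<Sum>f\<in>monics m. real_of_int (quad_char n (eval_ac f (root_ac P)))) / real CARD('a) ^ m"
  have r: "eval_ac P (root_ac P) = 0" by (rule eval_ac_root_ac[OF P])
  have term_eq: "(\<Sum>f\<in>monics m. of_int (poly_jacobi (smult c P) f) * of_real (pnorm f) powr (-1))
      = complex_of_real (?t m)" for m
  proof -
    have "of_int (poly_jacobi (smult c P) f) * of_real (pnorm f) powr (-1)
        = complex_of_real (real_of_int (twist_sign c n ^ m) *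
            real_of_int (quad_char n (eval_ac f (root_ac P))) / real CARD('a) ^ m)"
      if f: "f \<in> monics m" for f
    proof -
      have "pnorm f = real CARD('a) ^ m" using f by (auto simp: pnorm_def monics_def)
      moreover have "z powr (-1) = inverse z" if "z \<noteq> 0" for z :: complex
        using that powr_minus[of z 1] by simp
      ultimately show ?thesis
        unfolding poly_jacobi_reciprocity[OF odd P r f] by (simp add: divide_inverse)
    qed
    hence "(\<Sum>f\<in>monics m. of_int (poly_jacobi (smult c P) f) * of_real (pnorm f) powr (-1))
        = (\<Sum>f\<in>monics m. complex_of_real (real_of_int (twist_sign c n ^ m) *
            real_of_int (quad_char n (eval_ac f (root_ac P))) / real CARD('a) ^ m))"
      by (intro sum.cong) auto
    also have "\<dots> = complex_of_real (?t m)"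
      by (simp only: sum_distrib_left sum_divide_distrib of_real_sum)
    finally show ?thesis .
  qed
  have t0: "complex_of_real (?t m) = 0" if "m \<notin> {..<n}" for m
  proof -
    have "(\<Sum>f\<in>monics m. real_of_int (quad_char n (eval_ac f (root_ac P)))) = 0"
      using sum_monics_quad_char_eq_0[OF odd P r, of m] that by (simp flip: of_int_sum)
    thus ?thesis by (simp only: mult_zero_right div_0 of_real_0)
  qed
  have "(\<Sum>m. complex_of_real (?t m)) = (\<Sum>m<n. complex_of_real (?t m))"
    by (rule suminf_finite[OF _ t0]) auto
  thus ?thesis unfolding L_poly_def term_eq by simp
qed

text \<open>Monic squares give the main term. Every other \<open>f\<close> is bounded individually,
  and there are at most \<open>q ^ m\<close> of them.\<close>

lemma sum_prime_char_sum_eq: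
  fixes n :: nat
  defines "\<pi> \<equiv> real (card (monic_primes n :: 'a::{finite,field} poly set))"
    and "E \<equiv> CARD('a) ^ (n - n div 2)"
  assumes odd: "odd CARD('a)" and m: "m < n" and E: "5 \<le> E" "4 * n \<le> E"
  shows "\<bar>(\<Sum>f\<in>(monics m :: 'a poly set). real_of_int (prime_char_sum n f))
          - \<pi> * (if even m then real CARD('a) ^ (m div 2) else 0)\<bar> \<le> real CARD('a) ^ m * (8 * real E)"
proof -
  let ?M = "monics m :: 'a poly set" and ?S = "{f \<in> monics m :: 'a poly set. \<exists>l. f = l ^ 2}"
  have split: "(\<Sum>f\<in>?M. real_of_int (prime_char_sum n f))
      = (\<Sum>f\<in>?M - ?S. real_of_int (prime_char_sum n f)) + (\<Sum>f\<in>?S. real_of_int (prime_char_sum n f))"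
    by (rule sum.subset_diff) auto
  have "(\<Sum>f\<in>?S. real_of_int (prime_char_sum n f)) = (\<Sum>f\<in>?S. \<pi>)"
  proof (rule sum.cong[OF refl])
    fix f assume "f \<in> ?S"
    then obtain l where l: "f = l ^ 2" "f \<in> monics m" by blast
    have "l \<noteq> 0" using l by (auto simp: monics_def)
    moreover from this have "degree l \<le> m" using l by (auto simp: monics_def degree_power_eq)
    ultimately show "real_of_int (prime_char_sum n f) = \<pi>"
      using prime_char_sum_square[OF odd, of l n] m l(1) by (simp add: \<pi>_def)
  qed
  hence sq: "(\<Sum>f\<in>?S. real_of_int (prime_char_sum n f)) = \<pi> * (if even m then real CARD('a) ^ (m div 2) else 0)"
    using card_monic_squares[OF odd, of m] by simp
  have "\<bar>\<Sum>f\<in>?M - ?S. real_of_int (prime_char_sum n f)\<bar> \<le> (\<Sum>f\<in>?M - ?S. \<bar>real_of_int (prime_char_sum n f)\<bar>)"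
    by (rule sum_abs)
  also have "\<dots> \<le> (\<Sum>f\<in>?M - ?S. 8 * real E)"
  proof (rule sum_mono)
    fix f assume f: "f \<in> ?M - ?S"
    have "\<bar>prime_char_sum n f\<bar> \<le> 8 * int E"
      unfolding E_def by (rule abs_prime_char_sum_le[OF odd]) (use f m E in \<open>auto simp: monics_def E_def\<close>)
    hence "real_of_int \<bar>prime_char_sum n f\<bar> \<le> real_of_int (8 * int E)" by (simp only: of_int_le_iff)
    thus "\<bar>real_of_int (prime_char_sum n f)\<bar> \<le> 8 * real E" by simp
  qed
  also have "\<dots> \<le> (\<Sum>f\<in>?M. 8 * real E)" by (rule sum_mono2) auto
  also have "\<dots> = real CARD('a) ^ m * (8 * real E)" by (simp add: card_monics)
  finally show ?thesis unfolding split sq by simp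
qed

text \<open>Only \<open>m = 2 * k\<close> contributes, with the term \<open>1 / q ^ k\<close>: a
  geometric series cut off after \<open>(n + 1) div 2\<close> terms.\<close>

lemma sum_even_powers_eq:
  fixes q :: real
  assumes "q > 1"
  shows "(\<Sum>m<n. (if even m then q ^ (m div 2) else 0) / q ^ m)
         = (1 - 1 / q ^ ((n + 1) div 2)) / (1 - 1 / q)"
proof (induction n)
  case (Suc n)
  show ?case
  proof (cases "even n")
    case True
    then obtain k where k: "n = 2 * k" by (elim evenE)
    have "1 - 1 / q \<noteq> 0" using assms by simp
    hence "1 / q ^ k = 1 / q ^ k * (1 - 1 / q) / (1 - 1 / q)" by simp
    also have "1 / q ^ k * (1 - 1 / q) = 1 / q ^ k - 1 / q ^ (k + 1)" by (simp add: right_diff_distrib)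
    finally have "q ^ k / q ^ (2 * k) = (1 / q ^ k - 1 / q ^ (k + 1)) / (1 - 1 / q)"
      using assms by (simp add: mult_2 power_add)
    moreover have "(n + 1) div 2 = k" "(Suc n + 1) div 2 = k + 1" using k by auto
    ultimately show ?thesis
      using Suc True k by (simp only: sum.lessThan_Suc if_True) (simp add: diff_divide_distrib)
  next
    case False
    then obtain k where k: "n = 2 * k + 1" by (elim oddE)
    with Suc show ?thesis by simp
  qed
qed simp

text \<open>The 18 is 8 from the non-squares, for each of the \<open>n\<close> degrees, plus 10.
  With \<open>H = q ^ (n div 2)\<close>, replacing the prime count costs at most
  \<open>2 * H\<close>, cutting off the geometric series at most \<open>3 * H\<close>, and the zeta
  factor \<open>Z\<close> is at most 2.\<close>

lemma first_moment_bound: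
  fixes c :: "'a::{finite,field}" and n :: nat
  defines "q \<equiv> real CARD('a)" and "E \<equiv> CARD('a) ^ (n - n div 2)"
  assumes odd: "odd CARD('a)" and c: "c \<noteq> 0" and n: "n > 0" and E: "5 \<le> E" "4 * n \<le> E"
  shows "norm ((\<Sum>P\<in>(monic_primes n :: 'a poly set). L_poly 1 (smult c P))
            - zeta_A TYPE('a) 2 * of_real (q ^ n / n)) \<le> 18 * real n * real E"
proof -
  define \<pi> where "\<pi> = real (card (monic_primes n :: 'a poly set))"
  define s where "s = real_of_int (twist_sign c n)"
  have s: "s = 1 \<or> s = -1" using twist_sign_cases[OF c, of n] by (auto simp: s_def)
  have q: "q \<ge> 2" using card_field_gt_1[where 'a='a] by (simp add: q_def)
  define Z where "Z = 1 / (1 - 1 / q)"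
  have Z: "0 < Z" "Z \<le> 2" using q by (auto simp: Z_def field_simps)
  define W where "W = (\<lambda>m. if even m then q ^ (m div 2) else 0)"
  define R where "R = (\<Sum>m<n. s ^ m * (\<Sum>f\<in>(monics m :: 'a poly set). real_of_int (prime_char_sum n f)) / q ^ m)"
  have "(\<Sum>P\<in>(monic_primes n :: 'a poly set). L_poly 1 (smult c P))
      = of_real (\<Sum>P\<in>(monic_primes n :: 'a poly set). \<Sum>m<n. s ^ m *
          (\<Sum>f\<in>monics m. real_of_int (quad_char n (eval_ac f (root_ac P)))) / q ^ m)"
    unfolding of_real_sum by (intro sum.cong refl) (simp add: L_poly_1_eq[OF odd] s_def q_def)
  also have "(\<Sum>P\<in>(monic_primes n :: 'a poly set). \<Sum>m<n. s ^ m *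
          (\<Sum>f\<in>monics m. real_of_int (quad_char n (eval_ac f (root_ac P)))) / q ^ m) = R"
  proof -
    have "(\<Sum>P\<in>(monic_primes n :: 'a poly set). s ^ m *
          (\<Sum>f\<in>monics m. real_of_int (quad_char n (eval_ac f (root_ac P)))) / q ^ m)
        = s ^ m * (\<Sum>f\<in>(monics m :: 'a poly set). real_of_int (prime_char_sum n f)) / q ^ m" for m
    proof -
      have "(\<Sum>f\<in>(monics m :: 'a poly set). real_of_int (prime_char_sum n f)) =
          (\<Sum>P\<in>(monic_primes n :: 'a poly set). \<Sum>f\<in>monics m. real_of_int (quad_char n (eval_ac f (root_ac P))))"
        unfolding prime_char_sum_def of_int_sum by (rule sum.swap)
      thus ?thesis by (simp add: sum_distrib_left sum_divide_distrib)
    qed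
    thus ?thesis unfolding R_def by (subst sum.swap) simp
  qed
  finally have L: "(\<Sum>P\<in>(monic_primes n :: 'a poly set). L_poly 1 (smult c P)) = of_real R" .
  have "CARD('a) powr (1 - 2 :: complex) = 1 / of_real q"
    using powr_minus[of "of_nat CARD('a) :: complex" 1] by (simp add: q_def divide_inverse)
  hence zeta: "zeta_A TYPE('a) 2 = of_real Z"
    by (simp add: zeta_A_def Z_def)
  have main: "\<bar>R - \<pi> * (\<Sum>m<n. W m / q ^ m)\<bar> \<le> 8 * real n * real E"
  proof -
    have "\<bar>s ^ m * (\<Sum>f\<in>(monics m :: 'a poly set). real_of_int (prime_char_sum n f)) / q ^ m - \<pi> * (W m / q ^ m)\<bar>
        \<le> 8 * real E" if m: "m < n" for m
    proof -
      let ?T = "\<Sum>f\<in>(monics m :: 'a poly set). real_of_int (prime_char_sum n f)"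
      \<comment> \<open>Squares have even degree, where the twist sign disappears. Hence the main
        term has the same form for every \<open>c\<close> and both parities of
        \<open>n\<close>.\<close>
      have sW: "s ^ m * W m = W m" using s by (cases "even m") (auto simp: W_def)
      have "s ^ m * (?T - \<pi> * W m) = s ^ m * ?T - \<pi> * (s ^ m * W m)"
        by (simp only: right_diff_distrib mult.left_commute)
      hence "s ^ m * ?T / q ^ m - \<pi> * (W m / q ^ m) = s ^ m * (?T - \<pi> * W m) / q ^ m"
        unfolding sW by (simp add: diff_divide_distrib)
      moreover have "\<bar>s ^ m\<bar> = 1" using s by (auto simp: power_abs)
      ultimately have "\<bar>s ^ m * ?T / q ^ m - \<pi> * (W m / q ^ m)\<bar> = \<bar>?T - \<pi> * W m\<bar> / q ^ m"
        using q by (simp add: abs_mult)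
      also have "\<dots> \<le> (q ^ m * (8 * real E)) / q ^ m"
        using sum_prime_char_sum_eq[OF odd m] E q
        by (intro divide_right_mono) (auto simp: W_def \<pi>_def q_def E_def)
      also have "\<dots> = 8 * real E" using q by simp
      finally show ?thesis .
    qed
    hence "(\<Sum>m<n. \<bar>s ^ m * (\<Sum>f\<in>(monics m :: 'a poly set). real_of_int (prime_char_sum n f)) / q ^ m
        - \<pi> * (W m / q ^ m)\<bar>) \<le> (\<Sum>m<n. 8 * real E)"
      by (intro sum_mono) auto
    thus ?thesis unfolding R_def sum_distrib_left sum_subtractf[symmetric]
      by (intro order.trans[OF sum_abs]) (simp add: ac_simps)
  qed
  define k where "k = (n + 1) div 2"
  have W: "(\<Sum>m<n. W m / q ^ m) = Z * (1 - 1 / q ^ k)"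
    using sum_even_powers_eq[of q n] q by (simp add: W_def Z_def k_def)
  define H where "H = q ^ (n div 2)"
  have H1: "H \<ge> 1" using q by (simp add: H_def one_le_power)
  have HE: "H \<le> real E" unfolding H_def E_def q_def of_nat_power
    by (rule power_increasing) (use card_field_gt_1[where 'a='a] in auto)
  have n1: "real n \<ge> 1" using n by simp
  have "\<bar>real n * \<pi> - q ^ n\<bar> \<le> 2 * H"
    using abs_card_monic_primes_diff_le[OF n, where 'a='a] by (simp add: \<pi>_def q_def H_def)
  hence "\<bar>real n * (\<pi> - q ^ n / n)\<bar> \<le> 2 * H" using n1 by (simp add: right_diff_distrib)
  hence "real n * \<bar>\<pi> - q ^ n / n\<bar> \<le> 2 * H" by (simp add: abs_mult)
  moreover have "1 * \<bar>\<pi> - q ^ n / n\<bar> \<le> real n * \<bar>\<pi> - q ^ n / n\<bar>"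
    by (rule mult_right_mono[OF n1]) simp
  ultimately have pi: "\<bar>\<pi> - q ^ n / n\<bar> \<le> 2 * H" by simp
  \<comment> \<open>As \<open>k\<close> is the rounded-up half of \<open>n\<close>, the missing tail
    has size about \<open>q ^ (n - k) = H\<close>.\<close>
  have "n div 2 + k = n" unfolding k_def by presburger
  hence "q ^ n = H * q ^ k" unfolding H_def by (metis power_add)
  hence qn: "q ^ n / q ^ k = H" using q by simp
  have "q ^ n / n \<le> q ^ n / 1" using n1 q by (intro divide_left_mono) auto
  hence "\<pi> \<le> q ^ n + 2 * H" using pi by linarith
  also have "2 * H \<le> 2 * q ^ n" unfolding H_def using q by (intro mult_left_mono power_increasing) auto
  finally have "\<pi> \<le> 3 * q ^ n" by simp
  hence "\<pi> / q ^ k \<le> 3 * q ^ n / q ^ k" using q by (intro divide_right_mono) auto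
  hence pik: "\<pi> / q ^ k \<le> 3 * H" using qn by (simp add: field_simps)
  have pik0: "\<pi> / q ^ k \<ge> 0" using q by (simp add: \<pi>_def)
  have "\<bar>\<pi> * (\<Sum>m<n. W m / q ^ m) - Z * (q ^ n / n)\<bar> = Z * \<bar>(\<pi> - q ^ n / n) - \<pi> / q ^ k\<bar>"
  proof -
    have "\<pi> * (\<Sum>m<n. W m / q ^ m) - Z * (q ^ n / n) = Z * ((\<pi> - q ^ n / n) - \<pi> / q ^ k)"
      unfolding W by (simp add: algebra_simps)
    thus ?thesis using Z by (simp add: abs_mult)
  qed
  also have "\<dots> \<le> 2 * (5 * H)"
    using Z pi pik pik0 by (intro mult_mono) auto
  finally have "\<bar>R - Z * (q ^ n / n)\<bar> \<le> 8 * real n * real E + 10 * H" using main by linarith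
  also have "H \<le> real n * real E"
    using mult_mono[OF n1 HE] H1 by simp
  finally have "\<bar>R - Z * (q ^ n / n)\<bar> \<le> 18 * real n * real E" by (simp add: ac_simps)
  moreover have "of_real R - of_real Z * complex_of_real (q ^ n / n) = of_real (R - Z * (q ^ n / n))"
    by simp
  ultimately show ?thesis unfolding L zeta by (simp only: norm_of_real)
qed

lemma first_moment_bigo:
  fixes c :: "'a::{finite,field}" and N :: "nat \<Rightarrow> nat" and \<epsilon> :: real
  defines "q \<equiv> real CARD('a)"
  assumes odd: "odd CARD('a)" and c: "c \<noteq> 0" and \<epsilon>: "\<epsilon> > 0"
    and N: "\<And>g. N g > 0" "filterlim N at_top at_top"
  shows "(\<lambda>g. (\<Sum>P\<in>(monic_primes (N g) :: 'a poly set). L_poly 1 (smult c P))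
            - zeta_A TYPE('a) 2 * of_real (q ^ N g / log q (q ^ N g)))
         \<in> O(\<lambda>g. of_real ((q ^ N g) powr (1/2 + \<epsilon>)))"
proof -
  have q: "q \<ge> 2" using card_field_gt_1[where 'a='a] by (simp add: q_def)
  \<comment> \<open>The factor \<open>q\<close> pays for rounding \<open>n / 2\<close> up, and
    \<open>1 / (\<epsilon> * ln q)\<close> comes from estimating \<open>n\<close> by
    \<open>q powr (n * \<epsilon>)\<close> through \<open>x \<le> exp x\<close>.\<close>
  define C where "C = 18 * q / (\<epsilon> * ln q)"
  have lnq: "ln q > 0" using q by simp
  have bound: "norm ((\<Sum>P\<in>(monic_primes n :: 'a poly set). L_poly 1 (smult c P))
            - zeta_A TYPE('a) 2 * of_real (q ^ n / log q (q ^ n)))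
        \<le> C * norm (complex_of_real ((q ^ n) powr (1/2 + \<epsilon>)))"
    if n: "n > 0" and E: "5 \<le> CARD('a) ^ (n - n div 2)" "4 * n \<le> CARD('a) ^ (n - n div 2)" for n
  proof -
    have log: "log q (q ^ n) = n" using q by (simp add: log_nat_power)
    have "real (CARD('a) ^ (n - n div 2)) = q powr real (n - n div 2)"
      by (subst powr_realpow) (use q in \<open>auto simp: q_def\<close>)
    also have "\<dots> \<le> q powr (n / 2 + 1)"
      using q by (intro powr_mono) linarith+
    also have "\<dots> = q * q powr (n / 2)" using q by (simp add: powr_add)
    finally have 1: "real (CARD('a) ^ (n - n div 2)) \<le> q * q powr (n / 2)" .
    have "\<epsilon> * ln q * n \<le> exp (\<epsilon> * ln q * n)" using exp_ge_add_one_self[of "\<epsilon> * ln q * n"] by linarith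
    also have "\<dots> = q powr (n * \<epsilon>)" using q by (simp add: powr_def ac_simps)
    finally have 2: "real n \<le> q powr (n * \<epsilon>) / (\<epsilon> * ln q)"
      using \<epsilon> lnq by (simp add: field_simps)
    have "18 * real n * real (CARD('a) ^ (n - n div 2))
        \<le> 18 * (q powr (n * \<epsilon>) / (\<epsilon> * ln q)) * (q * q powr (n / 2))"
      by (intro mult_mono mult_left_mono 1 2) (use q \<epsilon> lnq in auto)
    also have "\<dots> = C * (q powr (n / 2) * q powr (n * \<epsilon>))" by (simp add: C_def)
    also have "q powr (n / 2) * q powr (n * \<epsilon>) = (q ^ n) powr (1/2 + \<epsilon>)"
      using q by (simp add: powr_powr algebra_simps flip: powr_realpow powr_add)
    finally show ?thesis
      using first_moment_bound[OF odd c n E] unfolding log q_def[symmetric] by simp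
  qed
  have ev: "eventually (\<lambda>n::nat. 5 \<le> CARD('a) ^ (n - n div 2) \<and> 4 * n \<le> CARD('a) ^ (n - n div 2)) at_top"
  proof (rule eventually_at_top_linorderI[of 12])
    fix n :: nat assume n: "12 \<le> n"
    define k where "k = n - n div 2"
    \<comment> \<open>From \<open>n = 12\<close> on, \<open>k\<close> is at least 6, the point after
      which \<open>8 * k \<le> 2 ^ k\<close> always holds. With \<open>n \<le> 2 * k\<close> this
      gives both conditions.\<close>
    have k: "k \<ge> 6" "n \<le> 2 * k" using n by (auto simp: k_def)
    have "8 * k \<le> 2 ^ k" using k(1) by (induction k rule: dec_induct) auto
    also have "\<dots> \<le> CARD('a) ^ k" by (rule power_mono) (use card_field_gt_1[where 'a='a] in auto)
    finally show "5 \<le> CARD('a) ^ (n - n div 2) \<and> 4 * n \<le> CARD('a) ^ (n - n div 2)"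
      using k unfolding k_def by linarith
  qed
  show ?thesis
    by (rule bigoI[of _ C]) (use eventually_compose_filterlim[OF ev N(2)] in eventually_elim, use bound N(1) in blast)
qed

theorem theorem2p9:
  fixes \<gamma> :: "'a::{finite,field}" and q :: real and \<epsilon> :: real
  assumes "q = real CARD('a)" and "odd CARD('a)"
    and "field_generator \<gamma>" and "\<epsilon> > 0"
  shows
    "(\<lambda>g::nat. (\<Sum>P\<in>(monic_primes (2*g+1) :: 'a poly set). L_poly 1 P)
        - zeta_A TYPE('a) 2 * of_real (q ^ (2*g+1) / log q (q ^ (2*g+1))))
      \<in> O(\<lambda>g. of_real ((q ^ (2*g+1)) powr (1/2 + \<epsilon>))) \<and>
     (\<lambda>g::nat. (\<Sum>P\<in>(monic_primes (2*g+2) :: 'a poly set). L_poly 1 P)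
        - zeta_A TYPE('a) 2 * of_real (q ^ (2*g+2) / log q (q ^ (2*g+2))))
      \<in> O(\<lambda>g. of_real ((q ^ (2*g+2)) powr (1/2 + \<epsilon>))) \<and>
     (\<lambda>g::nat. (\<Sum>P\<in>(monic_primes (2*g+2) :: 'a poly set). L_poly 1 (smult \<gamma> P))
        - zeta_A TYPE('a) 2 * of_real (q ^ (2*g+2) / log q (q ^ (2*g+2))))
      \<in> O(\<lambda>g. of_real ((q ^ (2*g+2)) powr (1/2 + \<epsilon>)))"
proof -
  have lim: "filterlim (\<lambda>g. 2 * g + k) at_top at_top" for k :: nat
    by (rule filterlim_at_top_mono[OF filterlim_ident]) auto
  have "\<gamma> \<noteq> 0" using assms(3) by (simp add: field_generator_def)
  \<comment> \<open>The three estimates are the cases \<open>c = 1\<close> in odd degree,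
    \<open>c = 1\<close> in even degree and \<open>c = \<gamma>\<close> in even degree.\<close>
  note * = first_moment_bigo[OF assms(2) _ assms(4), folded assms(1)]
  show ?thesis
    using *[of "1 :: 'a", OF _ _ lim[of 1]] *[of "1 :: 'a", OF _ _ lim[of 2]] *[OF \<open>\<gamma> \<noteq> 0\<close> _ lim[of 2]]
    by simp
qed

end
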